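(* Let $a\in C^\infty(\mathbb T;\mathbb R)$, let $a_0=\frac1{2\pi}\int_0^{2\pi}a(t)\,dt$, and let $L=\partial_t-a(t)\partial_x$ on $\mathbb T^2$. Assume that $a_0\in\mathbb R\setminus\mathbb Q$ has finite irrationality measure $\mu(a_0)$. Let $k>\mu(a_0)$, and suppose that $u\in\mathcal D'(\mathbb T^2)$ is a solution of $Lu=f$, with $f\in H^k(\mathbb T^2)$. Then $$u\in C^m(\mathbb T^2),\qquad m=\lceil k-\mu(a_0)\rceil-1.$$ In particular, if $k\in\mathbb N_0$, the same conclusion holds for every $f\in C^k(\mathbb T^2)$. If, in addition, $\widehat f(0,0)=0$, then there exists a unique distributional solution $u$ of $Lu=f$ satisfying $\widehat u(0,0)=0$, and this solution belongs to $C^m(\mathbb T^2)$ with the same $m$.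
   Context: $\mathbb T=\mathbb R/2\pi\mathbb Z$, with variables $(t,x)\in\mathbb T^2$ and dual frequencies $(\tau,\xi)\in\mathbb Z^2$; $\mathbb N_0$ denotes the nonnegative integers. $\mathcal D'(\mathbb T^2)$ is the space of distributions on $\mathbb T^2$. Fourier coefficients are $\widehat f(\tau,\xi)=\frac1{(2\pi)^2}\int_{\mathbb T^2}f(t,x)e^{-i(t\tau+x\xi)}\,dt\,dx$ (by duality for distributions). $\langle w\rangle=(1+|w|^2)^{1/2}$. For $s\in\mathbb R$, $H^s(\mathbb T^2)$ is the isotropic Sobolev space of $f\in\mathcal D'(\mathbb T^2)$ with $\sum_{(\tau,\xi)\in\mathbb Z^2}\langle(\tau,\xi)\rangle^{2s}|\widehat f(\tau,\xi)|^2<\infty$. The irrationality measure of $\alpha\in\mathbb R\setminus\mathbb Q$ is $\mu(\alpha)=\sup\{\nu>0:\ |\alpha-p/q|<q^{-\nu}\text{ for infinitely many }(p,q)\in\mathbb Z\times\mathbb N\}\in[2,\infty]$. *)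

theory Defs
  imports "HOL-Analysis.Analysis"
begin

text \<open>
  With \<open>\<T> = \<real> / 2\<pi>\<int>\<close>, functions on \<open>\<T>\<close> and on \<open>\<T>\<^sup>2\<close> are represented by \<open>2\<pi>\<close>-periodic
  functions on \<open>\<real>\<close> and \<open>\<real>\<^sup>2\<close>; a point of \<open>\<real>\<^sup>2\<close> is written \<open>(t, x)\<close>.
\<close>

definition periodic1 :: "(real \<Rightarrow> 'a) \<Rightarrow> bool" where
  "periodic1 g \<longleftrightarrow> (\<forall>t. g (t + 2 * pi) = g t)"

definition periodic2 :: "(real \<times> real \<Rightarrow> 'a) \<Rightarrow> bool" where
  "periodic2 g \<longleftrightarrow> (\<forall>t x. g (t + 2 * pi, x) = g (t, x) \<and> g (t, x + 2 * pi) = g (t, x))"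

definition smooth_circle :: "(real \<Rightarrow> real) set" where
  "smooth_circle = {a. periodic1 a \<and> (\<forall>n t. (deriv ^^ n) a differentiable (at t))}"

definition mean_circle :: "(real \<Rightarrow> real) \<Rightarrow> real" where
  "mean_circle a = 1 / (2 * pi) * integral {0..2 * pi} a"

definition partial_t :: "(real \<times> real \<Rightarrow> complex) \<Rightarrow> real \<times> real \<Rightarrow> complex" where
  "partial_t g = (\<lambda>(t, x). vector_derivative (\<lambda>s. g (s, x)) (at t))"

definition partial_x :: "(real \<times> real \<Rightarrow> complex) \<Rightarrow> real \<times> real \<Rightarrow> complex" where
  "partial_x g = (\<lambda>(t, x). vector_derivative (\<lambda>y. g (t, y)) (at x))"

primrec cont_diff :: "nat \<Rightarrow> (real \<times> real \<Rightarrow> complex) \<Rightarrow> bool" where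
  "cont_diff 0 g \<longleftrightarrow> continuous_on UNIV g"
| "cont_diff (Suc n) g \<longleftrightarrow>
     (\<forall>p. g differentiable (at p)) \<and> cont_diff n (partial_t g) \<and> cont_diff n (partial_x g)"

definition test_functions :: "(real \<times> real \<Rightarrow> complex) set" where
  "test_functions = {\<phi>. periodic2 \<phi> \<and> (\<forall>n. cont_diff n \<phi>)}"

text \<open>
  Distributions on \<open>\<T>\<^sup>2\<close> are the continuous linear functionals on the test functions, continuity
  for the Frechet topology being expressed by the usual seminorm estimate. Functionals are taken
  \<^const>\<open>extensional\<close>, i.e. with a fixed dummy value outside the test functions, so that equality
  of HOL functions is equality of distributions.
\<close>

definition distributions :: "((real \<times> real \<Rightarrow> complex) \<Rightarrow> complex) set" where
  "distributions = {u \<in> extensional test_functions.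
     (\<forall>\<phi>\<in>test_functions. \<forall>\<psi>\<in>test_functions. u (\<lambda>p. \<phi> p + \<psi> p) = u \<phi> + u \<psi>) \<and>
     (\<forall>c. \<forall>\<phi>\<in>test_functions. u (\<lambda>p. c * \<phi> p) = c * u \<phi>) \<and>
     (\<exists>C N. \<forall>\<phi>\<in>test_functions.
        norm (u \<phi>) \<le> C * (\<Sum>i\<le>N. \<Sum>j\<le>N. SUP p. norm ((partial_t ^^ i) ((partial_x ^^ j) \<phi>) p)))}"

definition distr_of :: "(real \<times> real \<Rightarrow> complex) \<Rightarrow> (real \<times> real \<Rightarrow> complex) \<Rightarrow> complex" where
  "distr_of g = (\<lambda>\<phi>\<in>test_functions. integral (cbox (0, 0) (2 * pi, 2 * pi)) (\<lambda>p. g p * \<phi> p))"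

definition distr_dt ::
  "((real \<times> real \<Rightarrow> complex) \<Rightarrow> complex) \<Rightarrow> (real \<times> real \<Rightarrow> complex) \<Rightarrow> complex" where
  "distr_dt u = (\<lambda>\<phi>\<in>test_functions. - u (partial_t \<phi>))"

definition distr_dx ::
  "((real \<times> real \<Rightarrow> complex) \<Rightarrow> complex) \<Rightarrow> (real \<times> real \<Rightarrow> complex) \<Rightarrow> complex" where
  "distr_dx u = (\<lambda>\<phi>\<in>test_functions. - u (partial_x \<phi>))"

definition distr_mult :: "(real \<times> real \<Rightarrow> complex) \<Rightarrow>
    ((real \<times> real \<Rightarrow> complex) \<Rightarrow> complex) \<Rightarrow> (real \<times> real \<Rightarrow> complex) \<Rightarrow> complex" where
  "distr_mult b u = (\<lambda>\<phi>\<in>test_functions. u (\<lambda>p. b p * \<phi> p))"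

definition vector_field_op :: "(real \<Rightarrow> real) \<Rightarrow>
    ((real \<times> real \<Rightarrow> complex) \<Rightarrow> complex) \<Rightarrow> (real \<times> real \<Rightarrow> complex) \<Rightarrow> complex" where
  "vector_field_op a u = (\<lambda>\<phi>\<in>test_functions.
     distr_dt u \<phi> - distr_mult (\<lambda>(t, x). complex_of_real (a t)) (distr_dx u) \<phi>)"

definition fourier_coeff :: "((real \<times> real \<Rightarrow> complex) \<Rightarrow> complex) \<Rightarrow> int \<times> int \<Rightarrow> complex" where
  "fourier_coeff u = (\<lambda>(\<tau>, \<xi>). 1 / (2 * complex_of_real pi)\<^sup>2 *
     u (\<lambda>(t, x). exp (- \<i> * complex_of_real (t * of_int \<tau> + x * of_int \<xi>))))"

definition bracket :: "int \<times> int \<Rightarrow> real" where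
  "bracket = (\<lambda>(\<tau>, \<xi>). sqrt (1 + (of_int \<tau>)\<^sup>2 + (of_int \<xi>)\<^sup>2))"

definition sobolev :: "real \<Rightarrow> ((real \<times> real \<Rightarrow> complex) \<Rightarrow> complex) set" where
  "sobolev s = {f \<in> distributions.
     (\<lambda>\<eta>. bracket \<eta> powr (2 * s) * (norm (fourier_coeff f \<eta>))\<^sup>2) summable_on UNIV}"

text \<open>The space \<open>C\<^sup>n(\<T>\<^sup>2)\<close>, embedded in the distributions.\<close>

definition cont_diff_distr :: "nat \<Rightarrow> ((real \<times> real \<Rightarrow> complex) \<Rightarrow> complex) set" where
  "cont_diff_distr n = distr_of ` {g. periodic2 g \<and> cont_diff n g}"

definition irrationality_measure :: "real \<Rightarrow> ereal" where
  "irrationality_measure \<alpha> = Sup {ereal \<nu> | \<nu>. 0 < \<nu> \<and>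
     infinite {(p :: int, q :: nat). 0 < q \<and>
       \<bar>\<alpha> - of_int p / of_nat q\<bar> < of_nat q powr (- \<nu>)}}"

end

theory Submission
  imports Defs
begin

text \<open>
  Write \<open>e\<^sub>\<eta>(t, x) = exp(i(t\<tau> + x\<xi>))\<close> for \<open>\<eta> = (\<tau>, \<xi>)\<close>. For each \<open>\<eta> \<noteq> 0\<close> the equation \<open>L E\<^sub>\<eta> = e\<^sub>\<eta>\<close>
  has a periodic solution \<open>E\<^sub>\<eta> = w(t) exp(ix\<xi>)\<close>, where \<open>w\<close> solves a linear ODE whose only obstruction is
  the divisor \<open>exp(2\<pi>i a\<^sub>0\<xi>) - 1\<close>; hence \<open>|E\<^sub>\<eta>| \<le> K \<langle>\<eta>\<rangle>\<^bsup>\<nu>-1\<^esup>\<close> for any \<open>\<nu> > \<mu>(a\<^sub>0)\<close>. For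
  \<open>f \<in> H\<^sup>k\<close> and \<open>m < k - \<nu>\<close>, Cauchy-Schwarz makes \<open>\<langle>\<eta>\<rangle>\<^bsup>m+\<nu>-1\<^esup> |c(\<eta>)|\<close> summable over the lattice, where
  \<open>c\<close> are the Fourier coefficients of \<open>f\<close>, so \<open>V[f] = \<Sum> c(\<eta>) E\<^sub>\<eta>\<close> converges. Since \<open>\<partial>\<^sub>x V[f] = V[\<partial>\<^sub>x f]\<close> and
  \<open>\<partial>\<^sub>t V[f] = a V[\<partial>\<^sub>x f] + f\<close>, induction on \<open>m\<close> shows that \<open>V[f]\<close> is \<open>C\<^sup>m\<close>. Applied to test functions,
  the same construction solves \<open>L \<psi> = \<phi>\<close> for every mean-zero test function \<open>\<phi>\<close>; as \<open>L\<close> is minus its own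
  transpose, a distributional solution is therefore determined by its mean.
\<close>

text \<open>Multiplication by \<open>a\<close> mixes the frequencies in \<open>t\<close>, so a
  double Fourier transform does not diagonalise L. Only \<open>x\<close> is separated, and the
  \<open>t\<close>-dependence of each mode stays a genuine function. A \<open>t\<close>-derivative
  of V[f] is therefore not a factor i \<tau> on coefficients; the equation itself is used to trade
  it for an \<open>x\<close>-derivative.

  Exponent count: passing from weighted square summability to absolute summability on a
  two-dimensional lattice costs 1, and the divisor costs \<nu> - 1, in total \<nu>. Since \<nu> may
  be any number above \<mu>, every integer m < k - \<mu> is reached, and the largest of these is the
  stated one.

  The regularity of a given u is not estimated directly, since nothing is known in advance about its
  order. It is compared with V[f] plus a constant of the same mean, and duality shows that the two
  agree. Test functions have rapidly decreasing coefficients, so the loss in the divisor, being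
  polynomial when \<mu> is finite, keeps the dual solution a test function.\<close>

declare split_paired_All [simp del] split_paired_Ex [simp del]

subsection \<open>Functions with continuous partial derivatives\<close>

text \<open>Names both partial derivatives and includes total differentiability, as
  \<open>cont_diff\<close> demands. Sums, products and series can then be differentiated by
  exhibiting the two partials.\<close>

definition has_partials ::
  "(real \<times> real \<Rightarrow> complex) \<Rightarrow> (real \<times> real \<Rightarrow> complex) \<Rightarrow> (real \<times> real \<Rightarrow> complex) \<Rightarrow> bool" where
  "has_partials g gt gx \<longleftrightarrow>
     (\<forall>p. (g has_derivative (\<lambda>h. fst h *\<^sub>R gt p + snd h *\<^sub>R gx p)) (at p))"

lemma has_partials_vector_derivatives:
  assumes "has_partials g gt gx"
  shows "((\<lambda>s. g (s, x)) has_vector_derivative gt (t, x)) (at t)"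
    and "((\<lambda>y. g (t, y)) has_vector_derivative gx (t, x)) (at x)"
proof -
  have d: "(g has_derivative (\<lambda>h. fst h *\<^sub>R gt (t, x) + snd h *\<^sub>R gx (t, x))) (at (t, x))"
    using assms by (simp add: has_partials_def)
  have "((\<lambda>s. (s, x)) has_derivative (\<lambda>h. (h, 0))) (at t)"
    by (auto intro!: derivative_eq_intros)
  from has_derivative_compose[OF this d]
  show "((\<lambda>s. g (s, x)) has_vector_derivative gt (t, x)) (at t)"
    by (simp add: has_vector_derivative_def)
  have "((\<lambda>y. (t, y)) has_derivative (\<lambda>h. (0, h))) (at x)"
    by (auto intro!: derivative_eq_intros)
  from has_derivative_compose[OF this d]
  show "((\<lambda>y. g (t, y)) has_vector_derivative gx (t, x)) (at x)"
    by (simp add: has_vector_derivative_def)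
qed

lemma has_partials_imp_eq:
  assumes "has_partials g gt gx"
  shows "partial_t g = gt" "partial_x g = gx"
  using has_partials_vector_derivatives[OF assms]
  by (auto simp: partial_t_def partial_x_def fun_eq_iff intro!: vector_derivative_at)

text \<open>A differential is fixed by its values on (1, 0) and (0, 1), and the chain rule along the
  two coordinate lines identifies these with the partial derivatives.\<close>

lemma has_partials_partial:
  assumes "\<And>p. g differentiable (at p)"
  shows "has_partials g (partial_t g) (partial_x g)"
  unfolding has_partials_def
proof
  fix p :: "real \<times> real"
  obtain t x where p: "p = (t, x)" by force
  obtain D where D: "(g has_derivative D) (at p)"
    using assms unfolding differentiable_def by blast
  then interpret D: bounded_linear D by (rule has_derivative_bounded_linear)
  define D' where "D' = (\<lambda>h::real\<times>real. fst h *\<^sub>R D (1,0) + snd h *\<^sub>R D (0,1))"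
  have DD: "D h = D' h" for h
  proof -
    have "h = fst h *\<^sub>R (1, 0) + snd h *\<^sub>R (0, 1)" by (simp add: prod_eq_iff)
    then have "D h = D (fst h *\<^sub>R (1, 0) + snd h *\<^sub>R (0, 1))" by simp
    then show ?thesis by (simp only: D'_def D.add D.scaleR)
  qed
  have Dp: "D (h, 0) = h *\<^sub>R D (1, 0)" "D (0, h) = h *\<^sub>R D (0, 1)" for h
    using D.scaleR[of h "(1, 0)"] D.scaleR[of h "(0, 1)"] by simp_all
  have "((\<lambda>s. (s, x)) has_derivative (\<lambda>h. (h, 0))) (at t)"
    by (auto intro!: derivative_eq_intros)
  from has_derivative_compose[OF this D[unfolded p]]
  have "((\<lambda>s. g (s, x)) has_vector_derivative D (1, 0)) (at t)"
    by (simp add: has_vector_derivative_def Dp[symmetric])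
  then have 1: "partial_t g p = D (1, 0)"
    by (simp add: partial_t_def p vector_derivative_at)
  have "((\<lambda>y. (t, y)) has_derivative (\<lambda>h. (0, h))) (at x)"
    by (auto intro!: derivative_eq_intros)
  from has_derivative_compose[OF this D[unfolded p]]
  have "((\<lambda>y. g (t, y)) has_vector_derivative D (0, 1)) (at x)"
    by (simp add: has_vector_derivative_def Dp[symmetric])
  then have 2: "partial_x g p = D (0, 1)"
    by (simp add: partial_x_def p vector_derivative_at)
  have "D = (\<lambda>h. fst h *\<^sub>R partial_t g p + snd h *\<^sub>R partial_x g p)"
    by (rule ext, subst DD) (simp only: D'_def 1 2)
  with D show "(g has_derivative (\<lambda>h. fst h *\<^sub>R partial_t g p + snd h *\<^sub>R partial_x g p)) (at p)"
    by simp
qed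

lemma has_partials_imp_differentiable: "has_partials g gt gx \<Longrightarrow> g differentiable (at p)"
  unfolding has_partials_def differentiable_def by blast

lemma has_partials_imp_continuous_on: "has_partials g gt gx \<Longrightarrow> continuous_on S g"
  by (meson continuous_at_imp_continuous_on differentiable_imp_continuous_within
      has_partials_imp_differentiable)

lemma cont_diff_Suc_iff:
  "cont_diff (Suc n) g \<longleftrightarrow> (\<exists>gt gx. has_partials g gt gx \<and> cont_diff n gt \<and> cont_diff n gx)"
  by (metis cont_diff.simps(2) has_partials_imp_differentiable has_partials_imp_eq has_partials_partial)

lemma cont_diff_SucI:
  "has_partials g gt gx \<Longrightarrow> cont_diff n gt \<Longrightarrow> cont_diff n gx \<Longrightarrow> cont_diff (Suc n) g"
  using cont_diff_Suc_iff by blast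

lemma cont_diff_Suc_has_partials: "cont_diff (Suc n) g \<Longrightarrow> has_partials g (partial_t g) (partial_x g)"
  by (simp add: has_partials_partial)

lemma cont_diff_SucD: "cont_diff (Suc n) g \<Longrightarrow> cont_diff n g"
proof (induction n arbitrary: g)
  case 0
  show ?case
    using has_partials_imp_continuous_on[OF cont_diff_Suc_has_partials[OF 0]] by simp
next
  case (Suc n)
  then show ?case by (metis cont_diff.simps(2))
qed

lemma cont_diff_mono: "cont_diff n g \<Longrightarrow> m \<le> n \<Longrightarrow> cont_diff m g"
  by (induction n) (use cont_diff_SucD le_Suc_eq in blast)+

lemma cont_diff_imp_continuous_on: "cont_diff n g \<Longrightarrow> continuous_on S g"
  using cont_diff_mono[of n g 0] continuous_on_subset by auto

lemma has_partials_const: "has_partials (\<lambda>p. c) (\<lambda>p. 0) (\<lambda>p. 0)"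
  by (simp add: has_partials_def)

lemma has_partials_add:
  "has_partials g gt gx \<Longrightarrow> has_partials h ht hx \<Longrightarrow>
    has_partials (\<lambda>p. g p + h p) (\<lambda>p. gt p + ht p) (\<lambda>p. gx p + hx p)"
  unfolding has_partials_def
  by (auto intro!: derivative_eq_intros simp: algebra_simps)

lemma has_partials_mult:
  "has_partials g gt gx \<Longrightarrow> has_partials h ht hx \<Longrightarrow>
    has_partials (\<lambda>p. g p * h p) (\<lambda>p. gt p * h p + g p * ht p) (\<lambda>p. gx p * h p + g p * hx p)"
  unfolding has_partials_def
  by (auto intro!: derivative_eq_intros simp: algebra_simps)

lemma has_partials_cmult:
  "has_partials g gt gx \<Longrightarrow> has_partials (\<lambda>p. c * g p) (\<lambda>p. c * gt p) (\<lambda>p. c * gx p)"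
  using has_partials_mult[OF has_partials_const[of c], of g gt gx] by simp

lemma cont_diff_const: "cont_diff n (\<lambda>p. c)"
proof (induction n arbitrary: c)
  case (Suc n)
  show ?case by (rule cont_diff_SucI[OF has_partials_const Suc Suc])
qed simp

lemma cont_diff_add: "cont_diff n g \<Longrightarrow> cont_diff n h \<Longrightarrow> cont_diff n (\<lambda>p. g p + h p)"
proof (induction n arbitrary: g h)
  case 0
  then show ?case by (auto intro: continuous_intros)
next
  case (Suc n)
  then show ?case unfolding cont_diff_Suc_iff by (blast intro: has_partials_add)
qed

lemma cont_diff_mult: "cont_diff n g \<Longrightarrow> cont_diff n h \<Longrightarrow> cont_diff n (\<lambda>p. g p * h p)"
proof (induction n arbitrary: g h)
  case 0
  then show ?case by (auto intro: continuous_intros)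
next
  case (Suc n)
  have "has_partials (\<lambda>p. g p * h p) (\<lambda>p. partial_t g p * h p + g p * partial_t h p)
      (\<lambda>p. partial_x g p * h p + g p * partial_x h p)"
    using Suc.prems by (intro has_partials_mult cont_diff_Suc_has_partials)
  then show ?case
    by (rule cont_diff_SucI) (use Suc.prems in \<open>auto intro!: cont_diff_add Suc.IH intro: cont_diff_SucD\<close>)
qed

lemma cont_diff_of_real_fst:
  assumes "\<And>n t. (deriv ^^ n) a differentiable (at t)"
  shows "cont_diff n (\<lambda>(t, x). complex_of_real (a t))"
  using assms
proof (induction n arbitrary: a)
  case 0
  have "continuous_on UNIV a"
    using differentiable_imp_continuous_within[OF 0[of 0, simplified]]
    by (rule continuous_at_imp_continuous_on[OF ballI])
  then have "continuous_on UNIV (\<lambda>p::real\<times>real. complex_of_real (a (fst p)))"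
    by (intro continuous_on_of_real continuous_on_compose2[of UNIV a UNIV fst] continuous_on_fst
        continuous_on_id subset_UNIV)
  then show ?case by (simp add: case_prod_unfold)
next
  case (Suc n)
  have "(a has_real_derivative deriv a t) (at t)" for t
    using Suc.prems[of 0] by (simp add: DERIV_deriv_iff_real_differentiable)
  then have "((\<lambda>p. a (fst p)) has_derivative (\<lambda>h. fst h * deriv a (fst p))) (at p)" for p :: "real\<times>real"
    using has_derivative_compose[OF bounded_linear_imp_has_derivative[OF bounded_linear_fst],
        of a "\<lambda>h. h * deriv a (fst p)" p UNIV]
    by (simp add: has_field_derivative_def mult_commute_abs)
  then have "has_partials (\<lambda>(t, x). complex_of_real (a t)) (\<lambda>(t, x). complex_of_real (deriv a t)) (\<lambda>p. 0)"
    unfolding has_partials_def case_prod_unfold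
    by (auto intro!: derivative_eq_intros simp: scaleR_conv_of_real)
  moreover have "cont_diff n (\<lambda>(t, x). complex_of_real (deriv a t))"
  proof (rule Suc.IH)
    fix n t show "(deriv ^^ n) (deriv a) differentiable at t"
      using Suc.prems[of "Suc n" t] by (simp add: funpow_swap1)
  qed
  ultimately show ?case using cont_diff_const cont_diff_SucI by blast
qed

section \<open>The characters of the torus\<close>

definition wave :: "int \<times> int \<Rightarrow> real \<times> real \<Rightarrow> complex" where
  "wave \<eta> p = exp (\<i> * of_real (fst p * of_int (fst \<eta>) + snd p * of_int (snd \<eta>)))"

lemma norm_wave [simp]: "norm (wave \<eta> p) = 1"
  by (simp add: wave_def del: of_real_add of_real_mult)

lemma wave_0 [simp]: "wave (0, 0) p = 1"
  by (simp add: wave_def)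

lemma wave_add: "wave (\<eta> + \<zeta>) p = wave \<eta> p * wave \<zeta> p"
  by (simp add: wave_def mult_exp_exp algebra_simps)

lemma wave_uminus: "wave (- \<eta>) p = cnj (wave \<eta> p)"
  by (simp add: wave_def exp_cnj algebra_simps)

lemma exp_add_2pi_int:
  "exp (\<i> * of_real (s * of_int n + 2 * pi * of_int n + r)) = exp (\<i> * of_real (s * of_int n + r))"
proof -
  have "exp (\<i> * of_real (s * of_int n + 2 * pi * of_int n + r))
      = exp (\<i> * of_real (s * of_int n + r)) * exp (of_int n * (of_real (2 * pi) * \<i>))"
    unfolding exp_add[symmetric] by (rule arg_cong[of _ _ exp]) (simp add: algebra_simps)
  then show ?thesis using exp_integer_2pi[of "of_int n"] by (simp add: mult_ac)
qed

lemma periodic2_wave: "periodic2 (wave \<eta>)"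
  unfolding periodic2_def
proof (intro allI conjI)
  fix t x
  show "wave \<eta> (t + 2 * pi, x) = wave \<eta> (t, x)"
    using exp_add_2pi_int[of t "fst \<eta>" "x * of_int (snd \<eta>)"] by (simp add: wave_def distrib_right)
  show "wave \<eta> (t, x + 2 * pi) = wave \<eta> (t, x)"
    using exp_add_2pi_int[of x "snd \<eta>" "t * of_int (fst \<eta>)"]
    by (simp add: wave_def distrib_right add_ac)
qed

lemma has_partials_wave:
  "has_partials (wave \<eta>) (\<lambda>p. \<i> * of_int (fst \<eta>) * wave \<eta> p) (\<lambda>p. \<i> * of_int (snd \<eta>) * wave \<eta> p)"
  unfolding has_partials_def
proof
  fix p :: "real \<times> real"
  let ?f = "\<lambda>p::real\<times>real. \<i> * of_real (fst p * of_int (fst \<eta>) + snd p * of_int (snd \<eta>))"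
  have "(?f has_derivative ?f) (at p)"
    by (auto intro!: derivative_eq_intros)
  then have "((\<lambda>p. exp (?f p)) has_derivative (\<lambda>h. exp (?f p) * ?f h)) (at p)"
    using has_derivative_compose[of ?f ?f p UNIV exp "\<lambda>h. exp (?f p) * h"] DERIV_exp
    unfolding has_field_derivative_def by auto
  then show "(wave \<eta> has_derivative (\<lambda>h. fst h *\<^sub>R (\<i> * of_int (fst \<eta>) * wave \<eta> p)
      + snd h *\<^sub>R (\<i> * of_int (snd \<eta>) * wave \<eta> p))) (at p)"
    unfolding wave_def by (simp add: scaleR_conv_of_real algebra_simps)
qed

lemma cont_diff_cmult_wave: "cont_diff n (\<lambda>p. c * wave \<eta> p)"
proof (induction n arbitrary: c)
  case 0
  show ?case using has_partials_imp_continuous_on[OF has_partials_cmult[OF has_partials_wave]] by simp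
next
  case (Suc n)
  show ?case
    by (rule cont_diff_SucI[OF has_partials_cmult[OF has_partials_wave]])
      (use Suc in \<open>simp_all add: mult.assoc[symmetric]\<close>)
qed

lemma cont_diff_wave: "cont_diff n (wave \<eta>)"
  using cont_diff_cmult_wave[of n 1 \<eta>] by simp

lemma wave_test_function [simp]: "wave \<eta> \<in> test_functions"
  by (simp add: test_functions_def cont_diff_wave periodic2_wave)

section \<open>Series of functions with a summable majorant\<close>

lemma continuous_on_series:
  fixes h :: "'i \<Rightarrow> 'a::topological_space \<Rightarrow> complex"
  assumes "\<And>i. continuous_on S (h i)" "\<And>i p. p \<in> S \<Longrightarrow> norm (h i p) \<le> M i" "M summable_on UNIV"
  shows "continuous_on S (\<lambda>p. \<Sum>\<^sub>\<infinity>i. h i p)"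
  by (rule uniform_limit_theorem[OF _ Weierstrass_m_test_general[of UNIV S h M]])
    (use assms in \<open>auto intro!: always_eventually continuous_intros\<close>)

lemma norm_le_summable_on:
  fixes h :: "'i \<Rightarrow> complex"
  assumes "\<And>i. norm (h i) \<le> M i" "M summable_on UNIV"
  shows "h summable_on UNIV"
  using assms summable_on_comparison_test[of M UNIV "\<lambda>i. norm (h i)"] abs_summable_summable[of h UNIV] by simp

text \<open>Termwise differentiation works along sequences, so the countable index type is
  enumerated; absolute convergence makes the limit independent of the enumeration. The common
  majorant makes the differentials converge uniformly as linear maps.\<close>

lemma has_partials_series:
  fixes h ht hx :: "'i::countable \<Rightarrow> real \<times> real \<Rightarrow> complex"
  assumes inf: "infinite (UNIV :: 'i set)"
    and part: "\<And>i. has_partials (h i) (ht i) (hx i)"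
    and bounds: "\<And>i p. norm (h i p) \<le> M i" "\<And>i p. norm (ht i p) \<le> M i" "\<And>i p. norm (hx i p) \<le> M i"
    and M: "M summable_on UNIV"
  shows "has_partials (\<lambda>p. \<Sum>\<^sub>\<infinity>i. h i p) (\<lambda>p. \<Sum>\<^sub>\<infinity>i. ht i p) (\<lambda>p. \<Sum>\<^sub>\<infinity>i. hx i p)"
proof -
  define b where "b = from_nat_into (UNIV :: 'i set)"
  have b: "bij_betw b UNIV UNIV"
    unfolding b_def using bij_betw_from_nat_into[OF _ inf] by simp
  have Mb: "summable (\<lambda>n. M (b n))"
    using M summable_on_reindex_bij_betw[OF b, of M] by (intro summable_on_imp_summable) simp
  have sm: "(\<lambda>n. f (b n)) sums (\<Sum>\<^sub>\<infinity>i. f i)" if "\<And>i. norm (f i) \<le> M i" for f :: "'i \<Rightarrow> complex"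
  proof -
    have "(f has_sum (\<Sum>\<^sub>\<infinity>i. f i)) UNIV"
      using norm_le_summable_on[OF that M] by simp
    then have "((\<lambda>n. f (b n)) has_sum (\<Sum>\<^sub>\<infinity>i. f i)) UNIV"
      using has_sum_reindex_bij_betw[OF b] by blast
    then show ?thesis by (rule has_sum_imp_sums)
  qed
  have ul: "uniform_limit UNIV (\<lambda>n p. \<Sum>i<n. f (b i) p) (\<lambda>p. \<Sum>\<^sub>\<infinity>i. f i p) sequentially"
    if "\<And>i p. norm (f i p) \<le> M i" for f :: "'i \<Rightarrow> real \<times> real \<Rightarrow> complex"
  proof -
    have "uniform_limit UNIV (\<lambda>n p. \<Sum>i<n. f (b i) p) (\<lambda>p. \<Sum>i. f (b i) p) sequentially"
      using that by (intro Weierstrass_m_test[OF _ Mb]) auto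
    moreover have "(\<Sum>i. f (b i) p) = (\<Sum>\<^sub>\<infinity>i. f i p)" for p
      using sm[of "\<lambda>i. f i p"] that by (simp add: sums_iff)
    ultimately show ?thesis by simp
  qed
  define T where "T = (\<lambda>p. \<Sum>\<^sub>\<infinity>i. ht i p)"
  define X where "X = (\<lambda>p. \<Sum>\<^sub>\<infinity>i. hx i p)"
  have "\<exists>g. \<forall>p\<in>UNIV. (\<lambda>n. h (b n) p) sums g p \<and>
      (g has_derivative (\<lambda>k. fst k *\<^sub>R T p + snd k *\<^sub>R X p)) (at p within UNIV)"
  proof (rule has_derivative_series[where f = "\<lambda>n. h (b n)"
        and f' = "\<lambda>n p k. fst k *\<^sub>R ht (b n) p + snd k *\<^sub>R hx (b n) p"])
    fix e :: real assume e: "e > 0"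
    have "\<forall>\<^sub>F n in sequentially. \<forall>p\<in>UNIV. dist (\<Sum>i<n. ht (b i) p) (T p) < e / 2"
      "\<forall>\<^sub>F n in sequentially. \<forall>p\<in>UNIV. dist (\<Sum>i<n. hx (b i) p) (X p) < e / 2"
      unfolding T_def X_def by (rule uniform_limitD[OF ul]; use bounds e in simp)+
    then show "\<forall>\<^sub>F n in sequentially. \<forall>p\<in>UNIV. \<forall>k. norm ((\<Sum>i<n. fst k *\<^sub>R ht (b i) p + snd k *\<^sub>R hx (b i) p)
        - (fst k *\<^sub>R T p + snd k *\<^sub>R X p)) \<le> e * norm k"
    proof eventually_elim
      case (elim n)
      show ?case
      proof (intro ballI allI)
        fix p and k :: "real \<times> real"
        have "(\<Sum>i<n. fst k *\<^sub>R ht (b i) p + snd k *\<^sub>R hx (b i) p) - (fst k *\<^sub>R T p + snd k *\<^sub>R X p)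
            = fst k *\<^sub>R ((\<Sum>i<n. ht (b i) p) - T p) + snd k *\<^sub>R ((\<Sum>i<n. hx (b i) p) - X p)"
          by (simp add: sum.distrib scaleR_sum_right scaleR_diff_right)
        also have "norm \<dots> \<le> \<bar>fst k\<bar> * norm ((\<Sum>i<n. ht (b i) p) - T p) + \<bar>snd k\<bar> * norm ((\<Sum>i<n. hx (b i) p) - X p)"
          by (metis norm_triangle_ineq norm_scaleR)
        also have "\<dots> \<le> norm k * (e / 2) + norm k * (e / 2)"
          using elim[THEN bspec[of _ _ p]] norm_fst_le[of "fst k" "snd k"] norm_snd_le[of "snd k" "fst k"]
          by (intro add_mono mult_mono) (auto simp: dist_norm less_imp_le)
        finally show "norm ((\<Sum>i<n. fst k *\<^sub>R ht (b i) p + snd k *\<^sub>R hx (b i) p)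
            - (fst k *\<^sub>R T p + snd k *\<^sub>R X p)) \<le> e * norm k" by (simp add: mult.commute)
      qed
    qed
  next
    show "(\<lambda>n. h (b n) 0) sums (\<Sum>\<^sub>\<infinity>i. h i 0)" using bounds by (intro sm) auto
  qed (use part in \<open>auto simp: has_partials_def\<close>)
  then obtain g where g: "\<And>p. (\<lambda>n. h (b n) p) sums g p"
    "\<And>p. (g has_derivative (\<lambda>k. fst k *\<^sub>R T p + snd k *\<^sub>R X p)) (at p)"
    by auto
  have "g p = (\<Sum>\<^sub>\<infinity>i. h i p)" for p
    using g(1)[of p] sm[of "\<lambda>i. h i p"] bounds sums_unique2 by blast
  then have "g = (\<lambda>p. \<Sum>\<^sub>\<infinity>i. h i p)" by auto
  with g(2) show ?thesis by (simp add: has_partials_def T_def X_def)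
qed

subsection \<open>Fourier coefficients of continuous functions\<close>

abbreviation torus :: "(real \<times> real) set" where
  "torus \<equiv> cbox (0, 0) (2 * pi, 2 * pi)"

lemma continuous_integrable_torus:
  "continuous_on UNIV g \<Longrightarrow> g integrable_on torus" for g :: "real \<times> real \<Rightarrow> 'b::banach"
  by (rule integrable_continuous) (auto intro: continuous_on_subset)

lemma integral_torus_add:
  "continuous_on UNIV g \<Longrightarrow> continuous_on UNIV h \<Longrightarrow>
    integral torus (\<lambda>p. g p + h p) = integral torus g + integral torus h" for g h :: "real \<times> real \<Rightarrow> complex"
  by (intro Henstock_Kurzweil_Integration.integral_add continuous_integrable_torus)

lemma integral_torus_diff:
  "continuous_on UNIV g \<Longrightarrow> continuous_on UNIV h \<Longrightarrow>
    integral torus (\<lambda>p. g p - h p) = integral torus g - integral torus h" for g h :: "real \<times> real \<Rightarrow> complex"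
  by (intro Henstock_Kurzweil_Integration.integral_diff continuous_integrable_torus)

lemma integral_torus_const: "integral torus (\<lambda>p. c) = 4 * pi\<^sup>2 * c" for c :: complex
  by (simp add: content_Pair scaleR_conv_of_real power2_eq_square)

lemma norm_integral_torus_le:
  fixes g :: "real \<times> real \<Rightarrow> complex"
  assumes "continuous_on UNIV g" "\<And>p. p \<in> torus \<Longrightarrow> norm (g p) \<le> B"
  shows "norm (integral torus g) \<le> 4 * pi\<^sup>2 * B"
proof -
  have "norm (integral torus g) \<le> integral torus (\<lambda>p. B)"
    using assms by (intro Henstock_Kurzweil_Integration.integral_norm_bound_integral
        continuous_integrable_torus) auto
  also have "\<dots> = 4 * pi\<^sup>2 * B" by (simp add: content_Pair power2_eq_square)
  finally show ?thesis .
qed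

lemma periodic2_of_int:
  assumes "periodic2 g"
  shows "g (t + 2 * pi * of_int m, x + 2 * pi * of_int n) = g (t, x)"
proof -
  have nat: "g (t + 2 * pi * of_nat m, x + 2 * pi * of_nat n) = g (t, x)" for t x m n
  proof -
    have "g (t + 2 * pi * of_nat m, x) = g (t, x)" for t x
    proof (induction m)
      case (Suc m)
      have "g (t + 2 * pi * of_nat m + 2 * pi, x) = g (t + 2 * pi * of_nat m, x)"
        using assms by (simp add: periodic2_def)
      then show ?case using Suc by (simp add: distrib_left add_ac)
    qed simp
    moreover have "g (t, x + 2 * pi * of_nat n) = g (t, x)" for t x
    proof (induction n)
      case (Suc n)
      have "g (t, x + 2 * pi * of_nat n + 2 * pi) = g (t, x + 2 * pi * of_nat n)"
        using assms by (simp add: periodic2_def)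
      then show ?case using Suc by (simp add: distrib_left add_ac)
    qed simp
    ultimately show ?thesis by simp
  qed
  have *: "g (t + 2 * pi * of_int m, x) = g (t, x)" for t x
  proof (cases "m \<ge> 0")
    case True
    then show ?thesis using nat[of t "nat m" x 0] by simp
  next
    case False
    then show ?thesis using nat[of "t + 2 * pi * of_int m" "nat (-m)" x 0] by (simp add: of_nat_nat)
  qed
  have "g (t, x + 2 * pi * of_int n) = g (t, x)" for t x
  proof (cases "n \<ge> 0")
    case True
    then show ?thesis using nat[of t 0 x "nat n"] by simp
  next
    case False
    then show ?thesis using nat[of t 0 "x + 2 * pi * of_int n" "nat (-n)"] by (simp add: of_nat_nat)
  qed
  with * show ?thesis by simp
qed

text \<open>The point \<open>q\<close> is chosen before \<open>g\<close>, so one reduction modulo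
  the periods serves every periodic function. Bounds and zeros found on the compact square then
  extend to the plane.\<close>

lemma periodic2_torus_representative:
  fixes p :: "real \<times> real"
  obtains q where "q \<in> torus" "\<forall>g :: real \<times> real \<Rightarrow> 'b. periodic2 g \<longrightarrow> g q = g p"
proof -
  define r where "r = (\<lambda>t. t + 2 * pi * of_int (- \<lfloor>t / (2 * pi)\<rfloor>))"
  have r: "0 \<le> r t \<and> r t \<le> 2 * pi" for t
  proof -
    have "r t = 2 * pi * frac (t / (2 * pi))" by (simp add: r_def frac_def algebra_simps)
    then show ?thesis using frac_lt_1[of "t / (2 * pi)"]
      by (metis less_imp_le mult_left_le frac_ge_0 mult_nonneg_nonneg pi_ge_zero zero_le_numeral)
  qed
  have "g (r (fst p), r (snd p)) = g p" if "periodic2 g" for g :: "real \<times> real \<Rightarrow> 'b"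
    unfolding r_def using that by (simp only: periodic2_of_int) simp
  moreover have "(r (fst p), r (snd p)) \<in> torus"
    using r by (auto simp: mem_box Basis_prod_def)
  ultimately show thesis using that by blast
qed

lemma periodic2_bounded:
  fixes g :: "real \<times> real \<Rightarrow> complex"
  assumes "periodic2 g" "continuous_on UNIV g"
  obtains B where "\<And>p. norm (g p) \<le> B"
proof -
  have "compact (g ` torus)"
    using assms by (intro compact_continuous_image) (auto intro: continuous_on_subset)
  then have "bounded (g ` torus)" by (rule compact_imp_bounded)
  then obtain B where B: "\<forall>p\<in>torus. norm (g p) \<le> B"
    unfolding bounded_iff by blast
  have "norm (g p) \<le> B" for p
  proof -
    obtain q where "q \<in> torus" "\<forall>g :: real \<times> real \<Rightarrow> complex. periodic2 g \<longrightarrow> g q = g p"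
      by (rule periodic2_torus_representative)
    with assms(1) B show ?thesis by metis
  qed
  then show thesis by (rule that)
qed

text \<open>A shift by a period leaves \<open>g\<close> unchanged, and a function has only one pair
  of partial derivatives.\<close>

lemma periodic2_partials:
  assumes "has_partials g gt gx" "periodic2 g"
  shows "periodic2 gt" "periodic2 gx"
proof -
  have *: "gt (p + v) = gt p \<and> gx (p + v) = gx p" if "\<And>p. g (p + v) = g p" for p v
  proof -
    have "(\<lambda>p. g (p + v)) = g" using that by auto
    moreover have "has_partials (\<lambda>p. g (p + v)) (\<lambda>p. gt (p + v)) (\<lambda>p. gx (p + v))"
      unfolding has_partials_def
    proof
      fix p
      have s: "((\<lambda>p. p + v) has_derivative (\<lambda>h. h)) (at p)" by (auto intro!: derivative_eq_intros)
      show "((\<lambda>p. g (p + v)) has_derivative (\<lambda>h. fst h *\<^sub>R gt (p + v) + snd h *\<^sub>R gx (p + v))) (at p)"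
        using assms(1) by (intro has_derivative_compose[OF s, of g]) (simp add: has_partials_def)
    qed
    ultimately have "has_partials g (\<lambda>p. gt (p + v)) (\<lambda>p. gx (p + v))" by simp
    from has_partials_imp_eq[OF this] has_partials_imp_eq[OF assms(1)]
    show ?thesis by (metis (full_types))
  qed
  have "g (p + (2 * pi, 0)) = g p" "g (p + (0, 2 * pi)) = g p" for p
    using assms(2) by (cases p; simp add: periodic2_def)+
  from *[of "(2 * pi, 0)", OF this(1)] *[of "(0, 2 * pi)", OF this(2)]
  have "gt (p + (2 * pi, 0)) = gt p \<and> gx (p + (2 * pi, 0)) = gx p"
    "gt (p + (0, 2 * pi)) = gt p \<and> gx (p + (0, 2 * pi)) = gx p" for p by auto
  from this[of "(_, _)"] show "periodic2 gt" "periodic2 gx"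
    by (auto simp: periodic2_def)
qed

section \<open>Integration by parts and Fourier coefficients of derivatives\<close>

lemma integral_torus_partials:
  assumes "has_partials g gt gx" "periodic2 g" "continuous_on UNIV gt" "continuous_on UNIV gx"
  shows "integral torus gt = 0" "integral torus gx = 0"
proof -
  have c: "continuous_on torus gt" "continuous_on torus gx"
    using assms(3,4) by (auto intro: continuous_on_subset)
  have t: "integral (cbox 0 (2 * pi)) (\<lambda>s. gt (s, x)) = 0" for x
  proof -
    have "((\<lambda>s. gt (s, x)) has_integral (g (2 * pi, x) - g (0, x))) {0..2 * pi}"
      by (rule fundamental_theorem_of_calculus)
        (auto intro!: has_vector_derivative_at_within has_partials_vector_derivatives[OF assms(1)])
    moreover have "g (2 * pi, x) = g (0, x)"
      using assms(2) by (metis periodic2_def add_0)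
    ultimately show ?thesis by (auto simp: integral_unique)
  qed
  have x: "integral (cbox 0 (2 * pi)) (\<lambda>y. gx (s, y)) = 0" for s
  proof -
    have "((\<lambda>y. gx (s, y)) has_integral (g (s, 2 * pi) - g (s, 0))) {0..2 * pi}"
      by (rule fundamental_theorem_of_calculus)
        (auto intro!: has_vector_derivative_at_within has_partials_vector_derivatives[OF assms(1)])
    moreover have "g (s, 2 * pi) = g (s, 0)"
      using assms(2) by (metis periodic2_def add_0)
    ultimately show ?thesis by (auto simp: integral_unique)
  qed
  show "integral torus gx = 0"
    using integral_prod_continuous[OF c(2)] x by simp
  \<comment> \<open>The iterated integral has \<open>x\<close> innermost, so the order is exchanged
    before the fundamental theorem of calculus is used in \<open>t\<close>.\<close>
  have "integral torus gt = integral (cbox 0 (2*pi)) (\<lambda>s. integral (cbox 0 (2*pi)) (\<lambda>y. gt (s, y)))"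
    by (rule integral_prod_continuous[OF c(1)])
  also have "\<dots> = integral (cbox 0 (2*pi)) (\<lambda>y. integral (cbox 0 (2*pi)) (\<lambda>s. gt (s, y)))"
    using integral_swap_continuous[of 0 0 "2*pi" "2*pi" "\<lambda>s y. gt (s, y)"] c(1) by simp
  also have "\<dots> = 0" using t by simp
  finally show "integral torus gt = 0" .
qed

lemma integral_torus_by_parts:
  assumes g: "has_partials g gt gx" "periodic2 g" "continuous_on UNIV gt" "continuous_on UNIV gx"
    and h: "has_partials h ht hx" "periodic2 h" "continuous_on UNIV ht" "continuous_on UNIV hx"
  shows "integral torus (\<lambda>p. gt p * h p) = - integral torus (\<lambda>p. g p * ht p)"
    and "integral torus (\<lambda>p. gx p * h p) = - integral torus (\<lambda>p. g p * hx p)"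
proof -
  have c: "continuous_on UNIV g" "continuous_on UNIV h"
    using g(1) h(1) by (auto intro: has_partials_imp_continuous_on)
  have p: "periodic2 (\<lambda>p. g p * h p)" using g(2) h(2) by (simp add: periodic2_def)
  have "integral torus (\<lambda>p. gt p * h p + g p * ht p) = 0"
    "integral torus (\<lambda>p. gx p * h p + g p * hx p) = 0"
    using integral_torus_partials[OF has_partials_mult[OF g(1) h(1)] p] g h c
    by (simp_all add: continuous_intros)
  then show "integral torus (\<lambda>p. gt p * h p) = - integral torus (\<lambda>p. g p * ht p)"
    and "integral torus (\<lambda>p. gx p * h p) = - integral torus (\<lambda>p. g p * hx p)"
    using g h c by (simp_all add: integral_torus_add continuous_intros eq_neg_iff_add_eq_0)
qed

lemma continuous_on_wave [continuous_intros]: "continuous_on S (wave \<eta>)"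
  by (rule cont_diff_imp_continuous_on[OF cont_diff_wave])

text \<open>A nonzero \<eta> has a nonzero component. That component times the character is, up to a
  factor \<i>, a partial derivative of a periodic function, so it integrates to 0.\<close>

lemma integral_torus_wave: "integral torus (wave \<eta>) = (if \<eta> = 0 then 4 * pi\<^sup>2 else 0)"
proof (cases "\<eta> = 0")
  case True
  then show ?thesis using integral_torus_const[of 1] by (simp add: zero_prod_def wave_0[abs_def])
next
  case False
  have "integral torus (\<lambda>p. \<i> * of_int (fst \<eta>) * wave \<eta> p) = 0"
    "integral torus (\<lambda>p. \<i> * of_int (snd \<eta>) * wave \<eta> p) = 0"
    by (rule integral_torus_partials[OF has_partials_wave periodic2_wave]; intro continuous_intros)+
  then show ?thesis using False by (auto simp: prod_eq_iff)
qed

text \<open>Kept apart from \<open>fourier_coeff\<close> so that continuous functions can be treated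
  before distributions enter; \<open>fourier_coeff_distr_of\<close> joins the two.\<close>

definition fourier_fun :: "(real \<times> real \<Rightarrow> complex) \<Rightarrow> int \<times> int \<Rightarrow> complex" where
  "fourier_fun g \<eta> = integral torus (\<lambda>p. g p * wave (- \<eta>) p) / (4 * pi\<^sup>2)"

lemma integral_torus_mult_wave: "integral torus (\<lambda>p. g p * wave \<eta> p) = 4 * pi\<^sup>2 * fourier_fun g (- \<eta>)"
  by (simp add: fourier_fun_def)

lemma fourier_fun_0: "fourier_fun g (0, 0) = integral torus g / (4 * pi\<^sup>2)"
  by (simp add: fourier_fun_def)

lemma fourier_fun_partials:
  assumes "has_partials g gt gx" "periodic2 g" "continuous_on UNIV gt" "continuous_on UNIV gx"
  shows "fourier_fun gt \<eta> = \<i> * of_int (fst \<eta>) * fourier_fun g \<eta>"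
    and "fourier_fun gx \<eta> = \<i> * of_int (snd \<eta>) * fourier_fun g \<eta>"
proof -
  have "integral torus (\<lambda>p. gt p * wave (-\<eta>) p)
      = - integral torus (\<lambda>p. g p * (\<i> * of_int (fst (-\<eta>)) * wave (-\<eta>) p))"
    "integral torus (\<lambda>p. gx p * wave (-\<eta>) p)
      = - integral torus (\<lambda>p. g p * (\<i> * of_int (snd (-\<eta>)) * wave (-\<eta>) p))"
    by (rule integral_torus_by_parts[OF assms has_partials_wave periodic2_wave]; intro continuous_intros)+
  moreover have "(\<lambda>p. g p * (\<i> * of_int k * wave (-\<eta>) p))
      = (\<lambda>p. \<i> * of_int k * (g p * wave (-\<eta>) p))" for k
    by (simp add: fun_eq_iff mult_ac)
  ultimately show "fourier_fun gt \<eta> = \<i> * of_int (fst \<eta>) * fourier_fun g \<eta>"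
    and "fourier_fun gx \<eta> = \<i> * of_int (snd \<eta>) * fourier_fun g \<eta>"
    by (simp_all add: fourier_fun_def)
qed

text \<open>The witness is the pure n-th derivative in one variable. Its continuity and its
  coefficients are what Bessel's inequality consumes when it bounds the weighted coefficients of
  \<open>g\<close>.\<close>

lemma fourier_fun_partials_funpow:
  assumes "cont_diff n g" "periodic2 g"
  shows "\<exists>h. periodic2 h \<and> continuous_on UNIV h \<and>
      fourier_fun h = (\<lambda>\<eta>. (\<i> * of_int (fst \<eta>)) ^ n * fourier_fun g \<eta>)"
    and "\<exists>h. periodic2 h \<and> continuous_on UNIV h \<and>
      fourier_fun h = (\<lambda>\<eta>. (\<i> * of_int (snd \<eta>)) ^ n * fourier_fun g \<eta>)"
  using assms
proof (induction n arbitrary: g)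
  case 0
  case 1 then show ?case by (intro exI[of _ g]) auto
  case 2 then show ?case by (intro exI[of _ g]) auto
next
  case (Suc n)
  have cd: "has_partials g (partial_t g) (partial_x g)"
      "cont_diff n (partial_t g)" "cont_diff n (partial_x g)" if "cont_diff (Suc n) g" for g
    using cont_diff_Suc_has_partials that by simp_all
  note p = periodic2_partials[OF cd(1)]
  note f = fourier_fun_partials[OF cd(1) _ cont_diff_imp_continuous_on[OF cd(2)]
      cont_diff_imp_continuous_on[OF cd(3)]]
  {
    case 1
    show ?case using Suc.IH(1)[OF cd(2)[OF 1(1)] p(1)[OF 1]]
      by (simp add: f[OF 1(1) 1(2) 1(1) 1(1)] mult_ac)
  next
    case 2
    show ?case using Suc.IH(2)[OF cd(3)[OF 2(1)] p(2)[OF 2]]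
      by (simp add: f[OF 2(1) 2(2) 2(1) 2(1)] mult_ac)
  }
qed

section \<open>Bessel's inequality\<close>

lemma Re_mult_cnj: "Re (z * cnj z) = (norm z)\<^sup>2"
  by (simp only: complex_norm_square[symmetric] Re_complex_of_real)

text \<open>\<open>S\<close> is the orthogonal projection of \<open>g\<close> onto the span of the
  characters in \<open>X\<close>. All three inner products involving \<open>S\<close> equal 4 pi^2
  Q, so the integral of |g - S|^2, which is nonnegative, is that of |g|^2 minus 4 pi^2 Q.\<close>

lemma Bessel_inequality:
  assumes g: "continuous_on UNIV g" and X: "finite X"
  shows "(\<Sum>\<eta>\<in>X. (norm (fourier_fun g \<eta>))\<^sup>2) \<le> Re (integral torus (\<lambda>p. g p * cnj (g p))) / (4 * pi\<^sup>2)"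
proof -
  define c where "c = fourier_fun g"
  define S where "S = (\<lambda>p. \<Sum>\<eta>\<in>X. c \<eta> * wave \<eta> p)"
  define Q where "Q = (\<Sum>\<eta>\<in>X. (norm (c \<eta>))\<^sup>2)"
  have S: "continuous_on UNIV S" unfolding S_def by (intro continuous_intros)
  have gS: "integral torus (\<lambda>p. g p * cnj (S p)) = 4 * pi\<^sup>2 * Q"
  proof -
    have "integral torus (\<lambda>p. g p * cnj (S p)) = integral torus (\<lambda>p. \<Sum>\<eta>\<in>X. cnj (c \<eta>) * (g p * wave (-\<eta>) p))"
      by (simp add: S_def sum_distrib_left wave_uminus mult_ac)
    also have "\<dots> = (\<Sum>\<eta>\<in>X. integral torus (\<lambda>p. cnj (c \<eta>) * (g p * wave (-\<eta>) p)))"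
      using X by (intro Henstock_Kurzweil_Integration.integral_sum continuous_integrable_torus continuous_intros g)
    also have "\<dots> = (\<Sum>\<eta>\<in>X. 4 * pi\<^sup>2 * (c \<eta> * cnj (c \<eta>)))"
      by (intro sum.cong refl) (simp add: c_def integral_torus_mult_wave)
    also have "\<dots> = 4 * pi\<^sup>2 * Q"
      by (simp add: Q_def sum_distrib_left flip: complex_norm_square)
    finally show ?thesis .
  qed
  have Sw: "integral torus (\<lambda>p. S p * cnj (wave \<zeta> p)) = 4 * pi\<^sup>2 * c \<zeta>" if "\<zeta> \<in> X" for \<zeta>
  proof -
    have "integral torus (\<lambda>p. S p * cnj (wave \<zeta> p)) = integral torus (\<lambda>p. \<Sum>\<eta>\<in>X. c \<eta> * wave (\<eta> + - \<zeta>) p)"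
      by (simp only: S_def sum_distrib_right wave_add wave_uminus mult.assoc)
    also have "\<dots> = (\<Sum>\<eta>\<in>X. integral torus (\<lambda>p. c \<eta> * wave (\<eta> + - \<zeta>) p))"
      using X by (intro Henstock_Kurzweil_Integration.integral_sum continuous_integrable_torus continuous_intros)
    also have "\<dots> = (\<Sum>\<eta>\<in>X. if \<eta> = \<zeta> then 4 * pi\<^sup>2 * c \<zeta> else 0)"
      by (intro sum.cong refl) (simp add: integral_torus_wave)
    finally show ?thesis using X that by simp
  qed
  have SS: "integral torus (\<lambda>p. S p * cnj (S p)) = 4 * pi\<^sup>2 * Q"
  proof -
    have "integral torus (\<lambda>p. S p * cnj (S p)) = integral torus (\<lambda>p. \<Sum>\<eta>\<in>X. cnj (c \<eta>) * (S p * cnj (wave \<eta> p)))"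
      by (simp add: S_def[THEN fun_cong, of _, THEN arg_cong[of _ _ cnj]] sum_distrib_left mult_ac)
    also have "\<dots> = (\<Sum>\<eta>\<in>X. integral torus (\<lambda>p. cnj (c \<eta>) * (S p * cnj (wave \<eta> p))))"
      using X S by (intro Henstock_Kurzweil_Integration.integral_sum continuous_integrable_torus continuous_intros)
    also have "\<dots> = (\<Sum>\<eta>\<in>X. 4 * pi\<^sup>2 * (c \<eta> * cnj (c \<eta>)))"
      by (intro sum.cong refl, subst Henstock_Kurzweil_Integration.integral_mult_right)
        (simp add: Sw)
    also have "\<dots> = 4 * pi\<^sup>2 * Q"
      by (simp add: Q_def sum_distrib_left flip: complex_norm_square)
    finally show ?thesis .
  qed
  have "integral torus (\<lambda>p. S p * cnj (g p)) = cnj (integral torus (\<lambda>p. g p * cnj (S p)))"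
    by (simp add: integral_cnj mult.commute)
  then have Sg: "integral torus (\<lambda>p. S p * cnj (g p)) = 4 * pi\<^sup>2 * Q"
    by (simp add: gS)
  have "integral torus (\<lambda>p. (g p - S p) * cnj (g p - S p))
      = integral torus (\<lambda>p. (g p * cnj (g p) - S p * cnj (g p)) - (g p * cnj (S p) - S p * cnj (S p)))"
    by (simp add: algebra_simps)
  also have "\<dots> = integral torus (\<lambda>p. g p * cnj (g p)) - 4 * pi\<^sup>2 * Q"
    using g S by (simp add: integral_torus_diff continuous_intros gS Sg SS)
  finally have eq: "integral torus (\<lambda>p. (g p - S p) * cnj (g p - S p))
      = integral torus (\<lambda>p. g p * cnj (g p)) - 4 * pi\<^sup>2 * Q" .
  have "Re (integral torus (\<lambda>p. (g p - S p) * cnj (g p - S p)))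
      = integral torus (\<lambda>p. Re ((g p - S p) * cnj (g p - S p)))"
    using g S integral_linear[OF continuous_integrable_torus bounded_linear_Re,
        of "\<lambda>p. (g p - S p) * cnj (g p - S p)"]
    by (simp add: o_def continuous_intros)
  also have "\<dots> \<ge> 0"
    by (rule Henstock_Kurzweil_Integration.integral_nonneg)
      (use g S in \<open>auto intro!: continuous_integrable_torus continuous_intros simp only: Re_mult_cnj zero_le_power2\<close>)
  finally have "Re (integral torus (\<lambda>p. g p * cnj (g p))) - 4 * pi\<^sup>2 * Q \<ge> 0"
    unfolding eq by simp
  then show ?thesis by (simp add: Q_def c_def field_simps)
qed

section \<open>Density of trigonometric polynomials and uniqueness of Fourier coefficients\<close>

inductive trig_poly :: "(real \<times> real \<Rightarrow> complex) \<Rightarrow> bool" where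
  trig_poly_wave: "trig_poly (\<lambda>p. c * wave \<eta> p)"
| trig_poly_add: "trig_poly f \<Longrightarrow> trig_poly g \<Longrightarrow> trig_poly (\<lambda>p. f p + g p)"

lemma trig_poly_const: "trig_poly (\<lambda>p. c)"
  using trig_poly_wave[of c "(0, 0)"] by simp

lemma trig_poly_cmult_wave: "trig_poly f \<Longrightarrow> trig_poly (\<lambda>p. c * wave \<eta> p * f p)"
proof (induction rule: trig_poly.induct)
  case (trig_poly_wave d \<zeta>)
  then show ?case using trig_poly.trig_poly_wave[of "c * d" "\<eta> + \<zeta>"] by (simp add: wave_add mult_ac)
next
  case (trig_poly_add f g)
  then show ?case using trig_poly.trig_poly_add by (simp add: distrib_left)
qed

lemma trig_poly_mult: "trig_poly f \<Longrightarrow> trig_poly g \<Longrightarrow> trig_poly (\<lambda>p. f p * g p)"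
proof (induction rule: trig_poly.induct)
  case (trig_poly_wave c \<eta>)
  then show ?case by (rule trig_poly_cmult_wave)
next
  case (trig_poly_add f g)
  then show ?case using trig_poly.trig_poly_add by (simp add: distrib_right)
qed

lemma trig_poly_continuous: "trig_poly f \<Longrightarrow> continuous_on UNIV f"
  by (induction rule: trig_poly.induct) (auto intro!: continuous_intros)

lemma trig_poly_integral_eq_0:
  assumes "trig_poly f" "continuous_on UNIV g" "\<And>\<eta>. fourier_fun g \<eta> = 0"
  shows "integral torus (\<lambda>p. g p * f p) = 0"
  using assms(1)
proof induction
  case (trig_poly_wave c \<eta>)
  have "(\<lambda>p. g p * (c * wave \<eta> p)) = (\<lambda>p. c * (g p * wave \<eta> p))" by (simp add: mult_ac)
  then show ?case using assms(3) by (simp add: integral_torus_mult_wave)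
next
  case (trig_poly_add f h)
  then show ?case
    using assms(2) by (simp add: distrib_left integral_torus_add continuous_intros trig_poly_continuous)
qed

text \<open>A real linear functional of (cis t, cis x) is a combination of the sines and cosines of
  t and x, hence of four characters; sums and products stay trigonometric polynomials.\<close>

lemma trig_poly_real_polynomial_function:
  assumes "real_polynomial_function q"
  shows "trig_poly (\<lambda>p. of_real (q (cis (fst p), cis (snd p))))"
  using assms
proof (induction rule: real_polynomial_function.induct)
  case (linear f)
  then interpret bounded_linear f .
  have cos: "complex_of_real (cos s) = (cis s + cis (- s)) / 2" for s
    by (simp add: complex_eq_iff)
  have sin: "complex_of_real (sin s) = - \<i> * (cis s - cis (- s)) / 2" for s
    by (simp add: complex_eq_iff)
  have w: "cis (fst p) = wave (1, 0) p" "cis (- fst p) = wave (-1, 0) p"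
    "cis (snd p) = wave (0, 1) p" "cis (- snd p) = wave (0, -1) p" for p
    by (simp_all add: wave_def cis_conv_exp)
  have "f (z, w) = Re z * f (1, 0) + Im z * f (\<i>, 0) + Re w * f (0, 1) + Im w * f (0, \<i>)" for z w
  proof -
    have "(z, w) = Re z *\<^sub>R (1, 0) + Im z *\<^sub>R (\<i>, 0) + Re w *\<^sub>R (0, 1) + Im w *\<^sub>R (0, \<i>)"
      by (simp add: prod_eq_iff complex_eq_iff)
    then have "f (z, w) = f (Re z *\<^sub>R (1, 0) + Im z *\<^sub>R (\<i>, 0) + Re w *\<^sub>R (0, 1) + Im w *\<^sub>R (0, \<i>))"
      by simp
    then show ?thesis by (simp only: add scaleR real_scaleR_def)
  qed
  from this[of "cis _" "cis _"] have f_cis: "f (cis s, cis r) =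
      cos s * f (1, 0) + sin s * f (\<i>, 0) + cos r * f (0, 1) + sin r * f (0, \<i>)" for s r by simp
  have "complex_of_real (f (cis (fst p), cis (snd p))) =
      (f (1, 0) / 2 * wave (1, 0) p + f (1, 0) / 2 * wave (-1, 0) p) +
      (- \<i> * f (\<i>, 0) / 2 * wave (1, 0) p + \<i> * f (\<i>, 0) / 2 * wave (-1, 0) p) +
      (f (0, 1) / 2 * wave (0, 1) p + f (0, 1) / 2 * wave (0, -1) p) +
      (- \<i> * f (0, \<i>) / 2 * wave (0, 1) p + \<i> * f (0, \<i>) / 2 * wave (0, -1) p)" for p
    by (simp add: f_cis cos sin flip: w) (simp add: field_simps)
  then show ?case
    by (simp only:) (intro trig_poly_add trig_poly_wave)
next
  case (const c)
  show ?case by (rule trig_poly_const)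
next
  case (add f g)
  then show ?case by (simp add: trig_poly_add)
next
  case (mult f g)
  then show ?case by (simp add: trig_poly_mult)
qed

text \<open>Stone-Weierstrass is applied on the compact image of the square under \<open>E\<close>,
  where the periodic \<open>g\<close> becomes a well-defined function \<open>G\<close>. Polynomial
  approximants of \<open>G\<close> pull back along \<open>E\<close> to trigonometric
  polynomials.\<close>

lemma trig_poly_approximation:
  fixes g :: "real \<times> real \<Rightarrow> complex"
  assumes g: "continuous_on UNIV g" "periodic2 g" and e: "e > 0"
  obtains h where "trig_poly h" "\<And>p. p \<in> torus \<Longrightarrow> norm (g p - h p) < e"
proof -
  define E where "E = (\<lambda>p. (cis (fst p), cis (snd p)))"
  define G where "G = (\<lambda>(z, w). g (Arg2pi z, Arg2pi w))"
  have GE: "G (E p) = g p" for p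
  proof -
    have *: "\<exists>n::int. s = Arg2pi (cis s) + 2 * pi * of_int n" for s
      using sin_cos_eq_iff[of s "Arg2pi (cis s)"] cos_Arg2pi[of "cis s"] sin_Arg2pi[of "cis s"]
      by simp
    obtain m n :: int where
      mn: "fst p = Arg2pi (cis (fst p)) + 2 * pi * of_int m" "snd p = Arg2pi (cis (snd p)) + 2 * pi * of_int n"
      using * by blast
    have "g p = g (fst p, snd p)" by simp
    also have "\<dots> = g (Arg2pi (cis (fst p)) + 2 * pi * of_int m, Arg2pi (cis (snd p)) + 2 * pi * of_int n)"
      using mn by simp
    also have "\<dots> = G (E p)"
      by (simp only: periodic2_of_int[OF g(2)]) (simp add: G_def E_def)
    finally show ?thesis by simp
  qed
  have contE: "continuous_on torus E"
    unfolding E_def by (intro continuous_intros)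
  \<comment> \<open>\<open>Arg2pi\<close> jumps on the positive axis, so continuity of
    \<open>G\<close> does not follow by composition. \<open>E\<close> on the compact square is a
    quotient map onto its image, and \<open>G\<close> after \<open>E\<close> is the continuous
    \<open>g\<close>.\<close>
  have "continuous_on (E ` torus) G"
    unfolding continuous_openin_preimage_eq
  proof (intro allI impI)
    fix T :: "complex set" assume "open T"
    have "openin (top_of_set torus) (torus \<inter> g -` T)"
      using continuous_on_subset[OF g(1), of torus] \<open>open T\<close>
      by (simp add: continuous_openin_preimage_eq)
    moreover have "torus \<inter> g -` T = torus \<inter> E -` (E ` torus \<inter> G -` T)"
      using GE by (simp add: set_eq_iff) blast
    ultimately show "openin (top_of_set (E ` torus)) (E ` torus \<inter> G -` T)"
      using Abstract_Topology_2.continuous_imp_quotient_map[OF contE refl compact_cbox, of "E ` torus \<inter> G -` T"] by simp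
  qed
  from Stone_Weierstrass_polynomial_function[OF compact_continuous_image[OF contE compact_cbox] this e]
  obtain q where q: "polynomial_function q" "\<And>z. z \<in> E ` torus \<Longrightarrow> norm (G z - q z) < e" by blast
  have "real_polynomial_function (\<lambda>z. Re (q z))" "real_polynomial_function (\<lambda>z. Im (q z))"
    using q(1) bounded_linear_Re bounded_linear_Im unfolding polynomial_function_def o_def by blast+
  then have "trig_poly (\<lambda>p. of_real (Re (q (E p))) + \<i> * of_real (Im (q (E p))))"
    unfolding E_def
    by (intro trig_poly_add trig_poly_mult trig_poly_const trig_poly_real_polynomial_function)
  then have "trig_poly (\<lambda>p. q (E p))" by (simp add: complex_eq[symmetric])
  moreover have "norm (g p - q (E p)) < e" if "p \<in> torus" for p
    using q(2)[of "E p"] that GE by simp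
  ultimately show thesis by (rule that)
qed

text \<open>With all coefficients zero, \<open>g\<close> is orthogonal to every trigonometric
  polynomial. Approximating the conjugate of \<open>g\<close> uniformly by such polynomials shows
  that |g|^2 has integral 0.\<close>

lemma fourier_fun_eq_0_imp_eq_0:
  assumes g: "continuous_on UNIV g" "periodic2 g" and z: "\<And>\<eta>. fourier_fun g \<eta> = 0"
  shows "g = (\<lambda>p. 0)"
proof -
  obtain B where B: "\<And>p. norm (g p) \<le> B" using periodic2_bounded g by blast
  then have "B \<ge> 0" using norm_ge_zero order_trans by blast
  have "norm (integral torus (\<lambda>p. g p * cnj (g p))) \<le> e" if "e > 0" for e
  proof -
    \<comment> \<open>Using \<open>B + 1\<close> instead of \<open>B\<close> keeps the quotient
      meaningful when the bound is 0.\<close>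
    define d where "d = e / (4 * pi\<^sup>2 * (B + 1))"
    have d: "d > 0" using that \<open>B \<ge> 0\<close> by (simp add: d_def)
    have "continuous_on UNIV (\<lambda>p. cnj (g p))" "periodic2 (\<lambda>p. cnj (g p))"
      using g by (auto intro: continuous_intros simp: periodic2_def)
    then obtain h where h: "trig_poly h" "\<And>p. p \<in> torus \<Longrightarrow> norm (cnj (g p) - h p) < d"
      using trig_poly_approximation d by blast
    have "integral torus (\<lambda>p. g p * cnj (g p))
        = integral torus (\<lambda>p. g p * h p + g p * (cnj (g p) - h p))"
      by (simp add: algebra_simps)
    also have "\<dots> = integral torus (\<lambda>p. g p * (cnj (g p) - h p))"
      using trig_poly_integral_eq_0[OF h(1) g(1) z] g(1) trig_poly_continuous[OF h(1)]
      by (simp add: integral_torus_add continuous_intros)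
    also have "norm \<dots> \<le> 4 * pi\<^sup>2 * (B * d)"
    proof (rule norm_integral_torus_le)
      fix p assume "p \<in> torus"
      from h(2)[OF this] show "norm (g p * (cnj (g p) - h p)) \<le> B * d"
        unfolding norm_mult using B \<open>B \<ge> 0\<close> by (intro mult_mono) auto
    qed (use g(1) trig_poly_continuous[OF h(1)] in \<open>auto intro!: continuous_intros\<close>)
    also have "\<dots> \<le> 4 * pi\<^sup>2 * ((B + 1) * d)" using d by (intro mult_left_mono mult_right_mono) auto
    also have "\<dots> = e" using \<open>B \<ge> 0\<close> by (simp add: d_def)
    finally show ?thesis .
  qed
  then have 0: "integral torus (\<lambda>p. g p * cnj (g p)) = 0"
    using field_le_epsilon[of "norm (integral torus (\<lambda>p. g p * cnj (g p)))" 0] by simp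
  have i: "(\<lambda>p. g p * cnj (g p)) integrable_on torus"
    using g by (intro continuous_integrable_torus continuous_intros)
  then have "((\<lambda>p. Re (g p * cnj (g p))) has_integral 0) torus"
    using has_integral_linear[OF integrable_integral[OF i] bounded_linear_Re] 0 by (simp add: o_def)
  then have *: "Re (g p * cnj (g p)) = 0" if "p \<in> torus" for p
  proof (rule has_integral_0_cbox_imp_0[rotated 2])
    show "continuous_on torus (\<lambda>p. Re (g p * cnj (g p)))"
      using g(1) by (intro continuous_intros) (auto intro: continuous_on_subset)
    have "(pi, pi) \<in> box (0, 0) (2 * pi, 2 * pi)" by (auto simp: mem_box Basis_prod_def)
    then show "box (0::real, 0::real) (2 * pi, 2 * pi) \<noteq> {}" by blast
  qed (use that in auto)
  have "g p = 0" for p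
  proof -
    obtain q where "q \<in> torus" "\<forall>g :: real \<times> real \<Rightarrow> complex. periodic2 g \<longrightarrow> g q = g p"
      by (rule periodic2_torus_representative)
    with g(2) have "q \<in> torus" "g q = g p" by auto
    with *[of q] show ?thesis by (simp only: Re_mult_cnj) simp
  qed
  then show ?thesis by blast
qed

subsection \<open>Weighted summability on the lattice\<close>

lemma bracket_ge_1: "1 \<le> bracket \<eta>"
  by (simp add: bracket_def case_prod_unfold)

lemma bracket_pos: "0 < bracket \<eta>"
  using bracket_ge_1[of \<eta>] by linarith

lemma bracket_nonneg [simp]: "0 \<le> bracket \<eta>"
  using bracket_pos[of \<eta>] by simp

lemma abs_bracket [simp]: "\<bar>bracket \<eta>\<bar> = bracket \<eta>"
  using bracket_pos[of \<eta>] by simp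

lemma bracket_square: "(bracket \<eta>)\<^sup>2 = 1 + (of_int (fst \<eta>))\<^sup>2 + (of_int (snd \<eta>))\<^sup>2"
  by (simp add: bracket_def case_prod_unfold)

lemma abs_fst_le_bracket: "\<bar>of_int (fst \<eta>)\<bar> \<le> bracket \<eta>"
  by (rule abs_le_square_iff[THEN iffD2, of _ "bracket \<eta>", simplified abs_bracket])
    (simp add: bracket_square)

lemma abs_snd_le_bracket: "\<bar>of_int (snd \<eta>)\<bar> \<le> bracket \<eta>"
  by (rule abs_le_square_iff[THEN iffD2, of _ "bracket \<eta>", simplified abs_bracket])
    (simp add: bracket_square)

text \<open>The cut-off \<open>max 1\<close> gives the value 1 at \<open>n = 0\<close>, whereas
  \<open>0 powr (- s)\<close> is 0 in HOL and could not serve in a majorant.\<close>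

lemma summable_on_int_max_powr:
  assumes "s > 1"
  shows "(\<lambda>n::int. max 1 \<bar>of_int n\<bar> powr (- s) :: real) summable_on UNIV"
proof -
  have "summable (\<lambda>n. real n powr (- s))"
    using assms by (simp add: summable_real_powr_iff)
  \<comment> \<open>Index 0, the only one at which the cut-off changes the term, is dropped here and
    restored below.\<close>
  then have "summable (\<lambda>n. real (Suc n) powr (- s))"
    by (subst summable_Suc_iff)
  moreover have "max 1 (real (Suc n)) = real (Suc n)" for n by simp
  ultimately have "summable (\<lambda>n. max 1 (real (Suc n)) powr (- s))" by simp
  then have "summable (\<lambda>n. max 1 (real n) powr (- s))"
    by (subst (asm) summable_Suc_iff)
  then have "(\<lambda>n. max 1 (real n) powr (- s)) summable_on UNIV"
    by (subst summable_on_UNIV_nonneg_real_iff) auto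
  then have "(\<lambda>n::int. max 1 \<bar>of_int n\<bar> powr (- s) :: real) summable_on range int"
    "(\<lambda>n::int. max 1 \<bar>of_int n\<bar> powr (- s) :: real) summable_on range (\<lambda>n. - int n)"
    by (simp_all add: summable_on_reindex inj_def o_def)
  then have "(\<lambda>n::int. max 1 \<bar>of_int n\<bar> powr (- s) :: real) summable_on (range int \<union> range (\<lambda>n. - int n))"
    by (rule summable_on_union)
  moreover have "range int \<union> range (\<lambda>n. - int n) = UNIV"
  proof -
    have "n \<in> range int \<union> range (\<lambda>n. - int n)" for n by (cases n rule: int_cases2) auto
    then show ?thesis by blast
  qed
  ultimately show ?thesis by simp
qed

text \<open>Each coordinate, cut off at 1, is at most the bracket. Giving half of the exponent to
  each coordinate bounds the sum by a product of two one-dimensional sums of exponent r / 2 >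
  1.\<close>

lemma summable_on_bracket_powr:
  assumes "r > 2"
  shows "(\<lambda>\<eta>. bracket \<eta> powr (- r)) summable_on UNIV"
proof -
  define g where "g = (\<lambda>n::int. max 1 \<bar>of_int n\<bar> powr (- (r / 2)) :: real)"
  have g: "(g has_sum infsum g UNIV) UNIV"
    using summable_on_int_max_powr[of "r / 2"] assms by (simp add: g_def)
  have "(\<lambda>\<eta>. g (fst \<eta>) * g (snd \<eta>)) summable_on UNIV \<times> UNIV"
  proof (rule summable_on_SigmaI)
    fix m :: int
    show "((\<lambda>n. g (fst (m, n)) * g (snd (m, n))) has_sum g m * infsum g UNIV) UNIV"
      using has_sum_cmult_right[OF g, of "g m"] by simp
    show "(\<lambda>m. g m * infsum g UNIV) summable_on UNIV"
      by (rule summable_on_cmult_left) (use g has_sum_imp_summable in blast)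
  qed (simp add: g_def)
  then have "(\<lambda>\<eta>. g (fst \<eta>) * g (snd \<eta>)) summable_on UNIV" by simp
  then show ?thesis
  proof (rule summable_on_comparison_test)
    fix \<eta> :: "int \<times> int"
    define u v where "u = max 1 \<bar>real_of_int (fst \<eta>)\<bar>" and "v = max 1 \<bar>real_of_int (snd \<eta>)\<bar>"
    have uv: "u > 0" "v > 0" "u \<le> bracket \<eta>" "v \<le> bracket \<eta>"
      using abs_fst_le_bracket abs_snd_le_bracket bracket_ge_1 by (auto simp: u_def v_def)
    have "bracket \<eta> powr (- r) = bracket \<eta> powr (- (r / 2)) * bracket \<eta> powr (- (r / 2))"
      by (simp flip: powr_add)
    also have "\<dots> \<le> u powr (- (r / 2)) * v powr (- (r / 2))"
      using uv assms by (intro mult_mono powr_mono2') auto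
    finally show "bracket \<eta> powr (- r) \<le> g (fst \<eta>) * g (snd \<eta>)"
      by (simp add: g_def u_def v_def)
  qed auto
qed

text \<open>A weighted l^1 condition, because the termwise arguments consume absolute convergence.
  One unit of \<open>s\<close> pays for one derivative.\<close>

definition wsummable :: "real \<Rightarrow> (int \<times> int \<Rightarrow> complex) \<Rightarrow> bool" where
  "wsummable s c \<longleftrightarrow> (\<lambda>\<eta>. bracket \<eta> powr s * norm (c \<eta>)) summable_on UNIV"

lemma wsummable_mono: "wsummable s c \<Longrightarrow> r \<le> s \<Longrightarrow> wsummable r c"
  unfolding wsummable_def
  by (erule summable_on_comparison_test) (auto intro!: mult_right_mono powr_mono bracket_ge_1)

text \<open>Cauchy-Schwarz in the termwise form u v \<le> u^2 + v^2. The second square is the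
  lattice series of exponent 2 (k - s), which converges above 2; this is the loss of one derivative,
  half the dimension.\<close>

lemma wsummable_l2:
  assumes "(\<lambda>\<eta>. bracket \<eta> powr (2 * k) * (norm (c \<eta>))\<^sup>2) summable_on UNIV" and "s < k - 1"
  shows "wsummable s c"
proof -
  have "(\<lambda>\<eta>. bracket \<eta> powr (2 * k) * (norm (c \<eta>))\<^sup>2 + bracket \<eta> powr (- (2 * (k - s)))) summable_on UNIV"
    using assms by (intro summable_on_add summable_on_bracket_powr) auto
  then show ?thesis unfolding wsummable_def
  proof (rule summable_on_comparison_test)
    fix \<eta>
    define u v where "u = bracket \<eta> powr k * norm (c \<eta>)" and "v = bracket \<eta> powr (s - k)"
    have nn: "u \<ge> 0" "v \<ge> 0" by (auto simp: u_def v_def)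
    have "0 \<le> (u - v)\<^sup>2" by simp
    then have "2 * (u * v) \<le> u\<^sup>2 + v\<^sup>2" by (simp add: power2_diff)
    moreover have "u * v \<ge> 0" using nn by simp
    ultimately have "u * v \<le> u\<^sup>2 + v\<^sup>2" by linarith
    moreover have "u * v = bracket \<eta> powr s * norm (c \<eta>)"
      by (simp add: u_def v_def mult_ac flip: powr_add)
    moreover have "u\<^sup>2 = bracket \<eta> powr (2 * k) * (norm (c \<eta>))\<^sup>2"
      by (simp add: u_def power2_eq_square mult_ac flip: powr_add)
    moreover have "v\<^sup>2 = bracket \<eta> powr (- (2 * (k - s)))"
      by (simp add: v_def power2_eq_square flip: powr_add)
    ultimately show "bracket \<eta> powr s * norm (c \<eta>)
        \<le> bracket \<eta> powr (2 * k) * (norm (c \<eta>))\<^sup>2 + bracket \<eta> powr (- (2 * (k - s)))" by simp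
  qed auto
qed

lemma wsummable_mult:
  assumes "wsummable (s + r) c" "\<And>\<eta>. norm (b \<eta>) \<le> C * bracket \<eta> powr r"
  shows "wsummable s (\<lambda>\<eta>. b \<eta> * c \<eta>)"
  unfolding wsummable_def
proof (rule summable_on_comparison_test)
  show "(\<lambda>\<eta>. C * (bracket \<eta> powr (s + r) * norm (c \<eta>))) summable_on UNIV"
    using assms(1) unfolding wsummable_def by (rule summable_on_cmult_right)
  show "bracket \<eta> powr s * norm (b \<eta> * c \<eta>) \<le> C * (bracket \<eta> powr (s + r) * norm (c \<eta>))" for \<eta>
  proof -
    have "bracket \<eta> powr s * norm (b \<eta> * c \<eta>) = (bracket \<eta> powr s * norm (c \<eta>)) * norm (b \<eta>)"
      by (simp add: norm_mult)
    also have "\<dots> \<le> (bracket \<eta> powr s * norm (c \<eta>)) * (C * bracket \<eta> powr r)"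
      by (intro mult_left_mono assms) auto
    finally show ?thesis by (simp add: powr_add mult_ac)
  qed
qed auto

lemma wsummable_fst: "wsummable (s + 1) c \<Longrightarrow> wsummable s (\<lambda>\<eta>. \<i> * of_int (fst \<eta>) * c \<eta>)"
  by (rule wsummable_mult[where C = 1 and r = 1]) (simp_all add: norm_mult abs_fst_le_bracket)

lemma wsummable_snd: "wsummable (s + 1) c \<Longrightarrow> wsummable s (\<lambda>\<eta>. \<i> * of_int (snd \<eta>) * c \<eta>)"
  by (rule wsummable_mult[where C = 1 and r = 1]) (simp_all add: norm_mult abs_snd_le_bracket)

subsection \<open>Fourier series\<close>

text \<open>Weierstrass' test along the filter of finite index sets gives uniform convergence, and
  uniform limits pass through the integral.\<close>

lemma has_sum_integral_torus:
  fixes h :: "'i \<Rightarrow> real \<times> real \<Rightarrow> complex"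
  assumes "\<And>i. continuous_on UNIV (h i)" "\<And>i p. norm (h i p) \<le> M i" "M summable_on UNIV"
  shows "((\<lambda>i. integral torus (h i)) has_sum integral torus (\<lambda>p. \<Sum>\<^sub>\<infinity>i. h i p)) UNIV"
proof -
  have ul: "uniform_limit torus (\<lambda>X p. \<Sum>i\<in>X. h i p) (\<lambda>p. \<Sum>\<^sub>\<infinity>i. h i p) (finite_subsets_at_top UNIV)"
    by (rule Weierstrass_m_test_general) (use assms in auto)
  have c: "continuous_on torus (h i)" for i
    using assms(1) continuous_on_subset by blast
  then have cX: "continuous_on torus (\<lambda>p. \<Sum>i\<in>X. h i p)" for X by (intro continuous_intros)
  obtain I J where I: "\<And>X. ((\<lambda>p. \<Sum>i\<in>X. h i p) has_integral I X) torus"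
    and J: "((\<lambda>p. \<Sum>\<^sub>\<infinity>i. h i p) has_integral J) torus" "(I \<longlongrightarrow> J) (finite_subsets_at_top UNIV)"
    by (rule uniform_limit_integral_cbox[OF ul cX finite_subsets_at_top_neq_bot]) (rule that)
  have "I X = (\<Sum>i\<in>X. integral torus (h i))" if "finite X" for X
  proof -
    have "I X = integral torus (\<lambda>p. \<Sum>i\<in>X. h i p)" by (rule integral_unique[OF I, symmetric])
    also have "\<dots> = (\<Sum>i\<in>X. integral torus (h i))"
      using that by (intro Henstock_Kurzweil_Integration.integral_sum integrable_continuous c)
    finally show ?thesis .
  qed
  then have "((\<lambda>X. \<Sum>i\<in>X. integral torus (h i)) \<longlongrightarrow> J) (finite_subsets_at_top UNIV)"
    using J(2) by (rule Lim_transform_eventually[rotated, OF eventually_finite_subsets_at_top_weakI]) auto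
  then show ?thesis using J(1) by (simp add: has_sum_def integral_unique)
qed

definition fourier_series :: "(int \<times> int \<Rightarrow> complex) \<Rightarrow> real \<times> real \<Rightarrow> complex" where
  "fourier_series c p = (\<Sum>\<^sub>\<infinity>\<eta>. c \<eta> * wave \<eta> p)"

lemma wsummable_0_iff: "wsummable 0 c \<longleftrightarrow> (\<lambda>\<eta>. norm (c \<eta>)) summable_on UNIV"
  using bracket_pos by (simp add: wsummable_def less_imp_neq[symmetric])

lemma continuous_on_fourier_series: "wsummable 0 c \<Longrightarrow> continuous_on S (fourier_series c)"
  unfolding fourier_series_def wsummable_0_iff
  by (rule continuous_on_series[where M = "\<lambda>\<eta>. norm (c \<eta>)"]) (auto intro!: continuous_intros simp: norm_mult)

lemma periodic2_fourier_series: "periodic2 (fourier_series c)"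
  using periodic2_wave by (simp add: periodic2_def fourier_series_def)

lemma has_partials_fourier_series:
  assumes "wsummable 1 c"
  shows "has_partials (fourier_series c) (fourier_series (\<lambda>\<eta>. \<i> * of_int (fst \<eta>) * c \<eta>))
    (fourier_series (\<lambda>\<eta>. \<i> * of_int (snd \<eta>) * c \<eta>))"
  unfolding fourier_series_def
proof (rule has_partials_series[where M = "\<lambda>\<eta>. bracket \<eta> powr 1 * norm (c \<eta>)"])
  show "infinite (UNIV :: (int \<times> int) set)" using infinite_UNIV_int by (simp add: finite_prod)
  show "has_partials (\<lambda>p. c \<eta> * wave \<eta> p) (\<lambda>p. \<i> * of_int (fst \<eta>) * c \<eta> * wave \<eta> p)
      (\<lambda>p. \<i> * of_int (snd \<eta>) * c \<eta> * wave \<eta> p)" for \<eta>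
    using has_partials_cmult[OF has_partials_wave, of "c \<eta>" \<eta>] by (simp add: mult_ac)
  show "(\<lambda>\<eta>. bracket \<eta> powr 1 * norm (c \<eta>)) summable_on UNIV"
    using assms by (simp add: wsummable_def)
  show "norm (c \<eta> * wave \<eta> p) \<le> bracket \<eta> powr 1 * norm (c \<eta>)" for \<eta> p
    using mult_right_mono[OF bracket_ge_1[of \<eta>] norm_ge_zero[of "c \<eta>"]] by (simp add: norm_mult)
qed (simp_all add: norm_mult mult_right_mono abs_fst_le_bracket abs_snd_le_bracket)

lemma cont_diff_fourier_series: "wsummable (real n) c \<Longrightarrow> cont_diff n (fourier_series c)"
proof (induction n arbitrary: c)
  case 0
  then show ?case by (simp add: continuous_on_fourier_series)
next
  case (Suc n)
  then have "wsummable 1 c" by (auto intro: wsummable_mono)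
  moreover have "wsummable (real n) (\<lambda>\<eta>. \<i> * of_int (fst \<eta>) * c \<eta>)"
    "wsummable (real n) (\<lambda>\<eta>. \<i> * of_int (snd \<eta>) * c \<eta>)"
    using Suc.prems by (auto intro!: wsummable_fst wsummable_snd simp: add.commute)
  ultimately show ?case using Suc.IH cont_diff_SucI has_partials_fourier_series by blast
qed

text \<open>Parseval's identity for the bilinear pairing. Neither factor is conjugated, hence the
  coefficient of \<open>g\<close> at - \<eta>; this is the pairing by which functions act on test
  functions.\<close>

lemma has_sum_integral_fourier_series_mult:
  assumes c: "wsummable 0 c" and g: "continuous_on UNIV g" "periodic2 g"
  shows "((\<lambda>\<eta>. 4 * pi\<^sup>2 * (c \<eta> * fourier_fun g (- \<eta>))) has_sum integral torus (\<lambda>p. fourier_series c p * g p)) UNIV"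
proof -
  obtain B where B: "\<And>p. norm (g p) \<le> B" using periodic2_bounded g by blast
  have "((\<lambda>\<eta>. integral torus (\<lambda>p. c \<eta> * (g p * wave \<eta> p))) has_sum
      integral torus (\<lambda>p. \<Sum>\<^sub>\<infinity>\<eta>. c \<eta> * (g p * wave \<eta> p))) UNIV"
  proof (rule has_sum_integral_torus)
    show "norm (c \<eta> * (g p * wave \<eta> p)) \<le> norm (c \<eta>) * B" for \<eta> p
      using B by (simp add: norm_mult mult_left_mono)
    show "(\<lambda>\<eta>. norm (c \<eta>) * B) summable_on UNIV"
      using c by (intro summable_on_cmult_left) (simp add: wsummable_0_iff)
  qed (intro continuous_intros g)
  moreover have "(\<Sum>\<^sub>\<infinity>\<eta>. c \<eta> * (g p * wave \<eta> p)) = fourier_series c p * g p" for p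
  proof -
    have "(\<Sum>\<^sub>\<infinity>\<eta>. c \<eta> * (g p * wave \<eta> p)) = (\<Sum>\<^sub>\<infinity>\<eta>. (c \<eta> * wave \<eta> p) * g p)"
      by (simp add: mult_ac)
    then show ?thesis by (simp add: fourier_series_def infsum_cmult_left')
  qed
  moreover have "integral torus (\<lambda>p. c \<eta> * (g p * wave \<eta> p)) = 4 * pi\<^sup>2 * (c \<eta> * fourier_fun g (- \<eta>))" for \<eta>
    by (simp add: integral_torus_mult_wave)
  ultimately show ?thesis by (simp only:)
qed

lemma fourier_fun_wave: "fourier_fun (wave \<eta>) \<zeta> = (if \<eta> = \<zeta> then 1 else 0)"
proof -
  have "(\<lambda>p. wave \<eta> p * wave (- \<zeta>) p) = wave (\<eta> - \<zeta>)" by (simp add: fun_eq_iff flip: wave_add)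
  then show ?thesis by (simp add: fourier_fun_def integral_torus_wave)
qed

lemma fourier_fun_fourier_series:
  assumes "wsummable 0 c"
  shows "fourier_fun (fourier_series c) = c"
proof
  fix \<eta>
  have "((\<lambda>\<zeta>. 4 * pi\<^sup>2 * (c \<zeta> * fourier_fun (wave (- \<eta>)) (- \<zeta>))) has_sum
      integral torus (\<lambda>p. fourier_series c p * wave (- \<eta>) p)) UNIV"
    by (intro has_sum_integral_fourier_series_mult assms continuous_intros periodic2_wave)
  moreover have "((\<lambda>\<zeta>. 4 * pi\<^sup>2 * (c \<zeta> * fourier_fun (wave (- \<eta>)) (- \<zeta>))) has_sum 4 * pi\<^sup>2 * c \<eta>) UNIV"
    by (rule has_sum_finite_neutralI[of "{\<eta>}"]) (auto simp: fourier_fun_wave)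
  ultimately have "integral torus (\<lambda>p. fourier_series c p * wave (- \<eta>) p) = 4 * pi\<^sup>2 * c \<eta>"
    by (rule has_sum_unique)
  then show "fourier_fun (fourier_series c) \<eta> = c \<eta>" by (simp add: fourier_fun_def)
qed

text \<open>The difference of \<open>g\<close> and its Fourier series is continuous and periodic
  with all coefficients zero, so uniqueness of the coefficients applies.\<close>

lemma fourier_inversion:
  assumes g: "continuous_on UNIV g" "periodic2 g" and w: "wsummable 0 (fourier_fun g)"
  shows "fourier_series (fourier_fun g) = g"
proof -
  define h where "h = (\<lambda>p. g p - fourier_series (fourier_fun g) p)"
  have "h = (\<lambda>p. 0)"
  proof (rule fourier_fun_eq_0_imp_eq_0)
    show "continuous_on UNIV h" unfolding h_def by (intro continuous_intros g continuous_on_fourier_series w)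
    show "periodic2 h" using g(2) periodic2_fourier_series by (simp add: h_def periodic2_def)
    fix \<eta>
    have "fourier_fun h \<eta> = fourier_fun g \<eta> - fourier_fun (fourier_series (fourier_fun g)) \<eta>"
      unfolding h_def fourier_fun_def[of "\<lambda>p. g p - _ p"] left_diff_distrib
      by (subst integral_torus_diff) (auto intro!: continuous_intros g continuous_on_fourier_series w
          simp: integral_torus_mult_wave diff_divide_distrib)
    then show "fourier_fun h \<eta> = 0" by (simp add: fourier_fun_fourier_series w)
  qed
  then show ?thesis by (simp add: h_def fun_eq_iff)
qed

lemma summable_on_fourier_fun_l2:
  assumes "continuous_on UNIV g"
  shows "(\<lambda>\<eta>. (norm (fourier_fun g \<eta>))\<^sup>2) summable_on UNIV"
  using Bessel_inequality[OF assms] by (intro nonneg_bounded_partial_sums_imp_summable_on) auto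

text \<open>This is the inclusion of C^n in H^n. Since (1 + u + v)^n is at most 3^n (1 + u^n + v^n)
  for nonnegative u and v, the function and its two pure n-th derivatives control the whole
  weight.\<close>

lemma summable_on_fourier_fun_cont_diff:
  assumes g: "cont_diff n g" "periodic2 g"
  shows "(\<lambda>\<eta>. bracket \<eta> powr (2 * real n) * (norm (fourier_fun g \<eta>))\<^sup>2) summable_on UNIV"
proof -
  let ?c = "\<lambda>\<eta>. (norm (fourier_fun g \<eta>))\<^sup>2"
  have sq: "(\<bar>x\<bar> ^ n)\<^sup>2 = (x\<^sup>2) ^ n" for x :: real
    by (metis power2_abs power_mult mult.commute)
  have t: "(\<lambda>\<eta>. (of_int (fst \<eta>))\<^sup>2 ^ n * ?c \<eta>) summable_on UNIV"
  proof -
    obtain h where "continuous_on UNIV h" "fourier_fun h = (\<lambda>\<eta>. (\<i> * of_int (fst \<eta>)) ^ n * fourier_fun g \<eta>)"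
      using fourier_fun_partials_funpow(1)[OF g] by blast
    with summable_on_fourier_fun_l2[of h] show ?thesis
      by (simp add: norm_mult norm_power power_mult_distrib sq)
  qed
  have x: "(\<lambda>\<eta>. (of_int (snd \<eta>))\<^sup>2 ^ n * ?c \<eta>) summable_on UNIV"
  proof -
    obtain h where "continuous_on UNIV h" "fourier_fun h = (\<lambda>\<eta>. (\<i> * of_int (snd \<eta>)) ^ n * fourier_fun g \<eta>)"
      using fourier_fun_partials_funpow(2)[OF g] by blast
    with summable_on_fourier_fun_l2[of h] show ?thesis
      by (simp add: norm_mult norm_power power_mult_distrib sq)
  qed
  have "(\<lambda>\<eta>. 3 ^ n * ((?c \<eta> + (of_int (fst \<eta>))\<^sup>2 ^ n * ?c \<eta>) + (of_int (snd \<eta>))\<^sup>2 ^ n * ?c \<eta>)) summable_on UNIV"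
    by (intro summable_on_cmult_right summable_on_add t x summable_on_fourier_fun_l2
        cont_diff_imp_continuous_on[OF g(1)])
  then show ?thesis
  proof (rule summable_on_comparison_test)
    fix \<eta>
    define u v where "u = (real_of_int (fst \<eta>))\<^sup>2" and "v = (real_of_int (snd \<eta>))\<^sup>2"
    have uv: "u \<ge> 0" "v \<ge> 0" by (auto simp: u_def v_def)
    define M where "M = max 1 (max u v)"
    have "bracket \<eta> powr (2 * real n) = ((bracket \<eta>)\<^sup>2) ^ n"
      using powr_realpow[OF bracket_pos, of \<eta> "2 * n"] by (simp add: power_mult)
    also have "\<dots> = (1 + u + v) ^ n" by (simp add: bracket_square u_def v_def)
    also have "\<dots> \<le> (3 * M) ^ n" using uv by (intro power_mono) (auto simp: M_def)
    also have "\<dots> = 3 ^ n * M ^ n" by (simp add: power_mult_distrib)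
    also have "M ^ n \<le> 1 + u ^ n + v ^ n" using uv by (auto simp: M_def max_def)
    finally have "bracket \<eta> powr (2 * real n) * ?c \<eta> \<le> 3 ^ n * (1 + u ^ n + v ^ n) * ?c \<eta>"
      by (intro mult_right_mono) auto
    then show "bracket \<eta> powr (2 * real n) * ?c \<eta>
        \<le> 3 ^ n * ((?c \<eta> + (of_int (fst \<eta>))\<^sup>2 ^ n * ?c \<eta>) + (of_int (snd \<eta>))\<^sup>2 ^ n * ?c \<eta>)"
      by (simp add: u_def v_def algebra_simps)
  qed auto
qed

lemma wsummable_fourier_fun_test_function:
  assumes "\<phi> \<in> test_functions"
  shows "wsummable s (fourier_fun \<phi>)"
proof -
  obtain n :: nat where "s + 1 < real n" using reals_Archimedean2 by blast
  then show ?thesis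
    using assms by (intro wsummable_l2[OF summable_on_fourier_fun_cont_diff[of n]]) (auto simp: test_functions_def)
qed

subsection \<open>Distributions on the torus\<close>

lemma test_functionsD:
  assumes "\<phi> \<in> test_functions"
  shows "periodic2 \<phi>" "cont_diff n \<phi>" "continuous_on S \<phi>" "has_partials \<phi> (partial_t \<phi>) (partial_x \<phi>)"
  using assms cont_diff_imp_continuous_on[of 0 \<phi>] cont_diff_Suc_has_partials[of 0 \<phi>]
  by (auto simp: test_functions_def simp del: cont_diff.simps)

lemma test_functions_partials:
  assumes "\<phi> \<in> test_functions"
  shows "partial_t \<phi> \<in> test_functions" "partial_x \<phi> \<in> test_functions"
  using periodic2_partials[OF test_functionsD(4)[OF assms] test_functionsD(1)[OF assms]]
    test_functionsD(2)[OF assms, of "Suc _"]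
  by (auto simp: test_functions_def)

lemma test_functions_add: "\<phi> \<in> test_functions \<Longrightarrow> \<psi> \<in> test_functions \<Longrightarrow> (\<lambda>p. \<phi> p + \<psi> p) \<in> test_functions"
  by (auto simp: test_functions_def periodic2_def intro: cont_diff_add)

lemma test_functions_const: "(\<lambda>p. c) \<in> test_functions"
  by (simp add: test_functions_def periodic2_def cont_diff_const)

lemma test_functions_mult: "\<phi> \<in> test_functions \<Longrightarrow> \<psi> \<in> test_functions \<Longrightarrow> (\<lambda>p. \<phi> p * \<psi> p) \<in> test_functions"
  by (auto simp: test_functions_def periodic2_def intro: cont_diff_mult)

lemma test_functions_cmult: "\<phi> \<in> test_functions \<Longrightarrow> (\<lambda>p. c * \<phi> p) \<in> test_functions"
  by (intro test_functions_mult test_functions_const)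

lemma test_functions_sum:
  "(\<And>i. i \<in> X \<Longrightarrow> \<phi> i \<in> test_functions) \<Longrightarrow> (\<lambda>p. \<Sum>i\<in>X. \<phi> i p) \<in> test_functions"
  by (induction X rule: infinite_finite_induct) (auto intro: test_functions_const test_functions_add)

lemma test_functions_fourier_series: "(\<And>s. wsummable s c) \<Longrightarrow> fourier_series c \<in> test_functions"
  by (simp add: test_functions_def periodic2_fourier_series cont_diff_fourier_series)

lemma distributionsD:
  assumes "u \<in> distributions"
  shows "u \<in> extensional test_functions"
    and "\<phi> \<in> test_functions \<Longrightarrow> \<psi> \<in> test_functions \<Longrightarrow> u (\<lambda>p. \<phi> p + \<psi> p) = u \<phi> + u \<psi>"
    and "\<phi> \<in> test_functions \<Longrightarrow> u (\<lambda>p. c * \<phi> p) = c * u \<phi>"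
  using assms by (auto simp: distributions_def)

lemma distribution_0: "u \<in> distributions \<Longrightarrow> u (\<lambda>p. 0) = 0"
  using distributionsD(3)[of u "\<lambda>p. 0" 0] test_functions_const by simp

lemma distribution_sum:
  assumes "u \<in> distributions" "\<And>i. i \<in> X \<Longrightarrow> \<phi> i \<in> test_functions"
  shows "u (\<lambda>p. \<Sum>i\<in>X. \<phi> i p) = (\<Sum>i\<in>X. u (\<phi> i))"
  using assms(2)
proof (induction X rule: infinite_finite_induct)
  case (insert i X)
  then have "u (\<lambda>p. \<phi> i p + (\<Sum>i\<in>X. \<phi> i p)) = u (\<phi> i) + u (\<lambda>p. \<Sum>i\<in>X. \<phi> i p)"
    by (intro distributionsD(2)[OF assms(1)] test_functions_sum) auto
  then show ?case using insert by simp
qed (simp_all add: distribution_0[OF assms(1)])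

lemma distribution_eqI:
  assumes "u \<in> extensional test_functions" "v \<in> extensional test_functions"
    and "\<And>\<phi>. \<phi> \<in> test_functions \<Longrightarrow> u \<phi> = v \<phi>"
  shows "u = v"
  using assms by (rule extensionalityI)

lemma distr_of_apply: "\<phi> \<in> test_functions \<Longrightarrow> distr_of g \<phi> = integral torus (\<lambda>p. g p * \<phi> p)"
  by (simp add: distr_of_def)

lemma distr_of_extensional: "distr_of g \<in> extensional test_functions"
  by (simp add: distr_of_def)

lemma distr_of_distribution:
  assumes g: "continuous_on UNIV g" "periodic2 g"
  shows "distr_of g \<in> distributions"
proof -
  obtain B where B: "\<And>p. norm (g p) \<le> B" using periodic2_bounded g by blast
  then have "B \<ge> 0" using norm_ge_zero order_trans by blast
  have "norm (distr_of g \<phi>) \<le> 4 * pi\<^sup>2 * B * (SUP p. norm (\<phi> p))" if "\<phi> \<in> test_functions" for \<phi>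
  proof -
    note \<phi> = test_functionsD[OF that]
    obtain B' where B': "\<And>p. norm (\<phi> p) \<le> B'" using periodic2_bounded \<phi>(1,3) by blast
    then have bdd: "bdd_above (range (\<lambda>p. norm (\<phi> p)))" by (intro bdd_aboveI2)
    have "norm (integral torus (\<lambda>p. g p * \<phi> p)) \<le> 4 * pi\<^sup>2 * (B * (SUP p. norm (\<phi> p)))"
      using B \<open>B \<ge> 0\<close> cSUP_upper[OF UNIV_I bdd]
      by (intro norm_integral_torus_le continuous_intros g \<phi>) (auto simp: norm_mult intro!: mult_mono)
    then show ?thesis using that by (simp add: distr_of_apply)
  qed
  \<comment> \<open>Integration against a bounded function is a distribution of order zero, so
    \<open>N = 0\<close> works and the double sum is the single supremum of \<phi>.\<close>
  then have "\<exists>C N. \<forall>\<phi>\<in>test_functions.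
      norm (distr_of g \<phi>) \<le> C * (\<Sum>i\<le>N. \<Sum>j\<le>N. SUP p. norm ((partial_t ^^ i) ((partial_x ^^ j) \<phi>) p))"
    by (intro exI[of _ "4 * pi\<^sup>2 * B"] exI[of _ 0]) simp
  moreover have "distr_of g (\<lambda>p. \<phi> p + \<psi> p) = distr_of g \<phi> + distr_of g \<psi>"
    if "\<phi> \<in> test_functions" "\<psi> \<in> test_functions" for \<phi> \<psi>
    using that test_functionsD(3) g
    by (simp add: distr_of_apply test_functions_add distrib_left integral_torus_add continuous_intros)
  moreover have "distr_of g (\<lambda>p. c * \<phi> p) = c * distr_of g \<phi>" if "\<phi> \<in> test_functions" for c \<phi>
    using that by (simp add: distr_of_apply test_functions_cmult mult.left_commute)
  ultimately show ?thesis by (simp add: distributions_def distr_of_extensional)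
qed

lemma fourier_coeff_eq: "fourier_coeff u \<eta> = u (wave (- \<eta>)) / (4 * pi\<^sup>2)"
proof -
  have "wave (- \<eta>) = (\<lambda>(t, x). exp (- \<i> * complex_of_real (t * of_int (fst \<eta>) + x * of_int (snd \<eta>))))"
    by (auto simp: wave_def fun_eq_iff algebra_simps)
  then show ?thesis by (simp add: fourier_coeff_def case_prod_unfold power_mult_distrib)
qed

lemma fourier_coeff_0: "fourier_coeff u (0, 0) = u (\<lambda>p. 1) / (4 * pi\<^sup>2)"
  by (simp add: fourier_coeff_eq wave_0[abs_def])

lemma fourier_coeff_distr_of: "fourier_coeff (distr_of g) \<eta> = fourier_fun g \<eta>"
  by (simp add: fourier_coeff_eq distr_of_apply fourier_fun_def)

section \<open>Fourier expansion of distributions\<close>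

lemma fourier_series_split:
  assumes "wsummable 0 c" "finite X"
  shows "fourier_series c p = (\<Sum>\<eta>\<in>X. c \<eta> * wave \<eta> p) + fourier_series (\<lambda>\<eta>. if \<eta> \<in> X then 0 else c \<eta>) p"
proof -
  have s: "(\<lambda>\<eta>. c \<eta> * wave \<eta> p) summable_on UNIV"
    using assms(1) unfolding wsummable_0_iff by (rule norm_le_summable_on[rotated]) (simp add: norm_mult)
  have "fourier_series c p = (\<Sum>\<^sub>\<infinity>\<eta>\<in>X \<union> - X. c \<eta> * wave \<eta> p)" by (simp add: fourier_series_def)
  also have "\<dots> = (\<Sum>\<^sub>\<infinity>\<eta>\<in>X. c \<eta> * wave \<eta> p) + (\<Sum>\<^sub>\<infinity>\<eta>\<in>- X. c \<eta> * wave \<eta> p)"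
    by (rule infsum_Un_disjoint) (use s in \<open>auto intro: summable_on_subset_banach\<close>)
  also have "(\<Sum>\<^sub>\<infinity>\<eta>\<in>- X. c \<eta> * wave \<eta> p) = fourier_series (\<lambda>\<eta>. if \<eta> \<in> X then 0 else c \<eta>) p"
    unfolding fourier_series_def by (rule infsum_cong_neutral) auto
  finally show ?thesis using assms(2) by simp
qed

lemma norm_fourier_series_le:
  assumes "wsummable 0 c"
  shows "norm (fourier_series c p) \<le> (\<Sum>\<^sub>\<infinity>\<eta>. norm (c \<eta>))"
  using norm_infsum_bound[of "\<lambda>\<eta>. c \<eta> * wave \<eta> p" UNIV] assms
  by (simp add: fourier_series_def norm_mult wsummable_0_iff)

lemma partials_fourier_series_funpow:
  assumes "\<And>s. wsummable s c"
  shows "(partial_t ^^ i) ((partial_x ^^ j) (fourier_series c))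
    = fourier_series (\<lambda>\<eta>. (\<i> * of_int (fst \<eta>)) ^ i * ((\<i> * of_int (snd \<eta>)) ^ j * c \<eta>))"
proof -
  have x: "wsummable s (\<lambda>\<eta>. (\<i> * of_int (snd \<eta>)) ^ j * c \<eta>) \<and>
    (partial_x ^^ j) (fourier_series c) = fourier_series (\<lambda>\<eta>. (\<i> * of_int (snd \<eta>)) ^ j * c \<eta>)" for s j
  proof (induction j arbitrary: s)
    case (Suc j)
    show ?case
      using wsummable_snd[of s, OF Suc[THEN conjunct1]] Suc[THEN conjunct2]
        has_partials_imp_eq(2)[OF has_partials_fourier_series[OF Suc[THEN conjunct1]]]
      by (simp add: mult.assoc)
  qed (simp add: assms)
  have t: "wsummable s (\<lambda>\<eta>. (\<i> * of_int (fst \<eta>)) ^ i * c \<eta>) \<and>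
    (partial_t ^^ i) (fourier_series c) = fourier_series (\<lambda>\<eta>. (\<i> * of_int (fst \<eta>)) ^ i * c \<eta>)"
    if "\<And>s. wsummable s c" for s i c
  proof (induction i arbitrary: s)
    case (Suc i)
    show ?case
      using wsummable_fst[of s, OF Suc[THEN conjunct1]] Suc[THEN conjunct2]
        has_partials_imp_eq(1)[OF has_partials_fourier_series[OF Suc[THEN conjunct1]]]
      by (simp add: mult.assoc)
  qed (simp add: that)
  show ?thesis using t[of "\<lambda>\<eta>. (\<i> * of_int (snd \<eta>)) ^ j * c \<eta>"] x by simp
qed

text \<open>The Fourier series of \<phi> converges in the topology of test functions, for which
  \<open>u\<close> is continuous: each seminorm of the remainder after removing \<open>X\<close> is
  bounded by the tail outside \<open>X\<close> of a convergent series.\<close>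

lemma distribution_has_sum:
  assumes u: "u \<in> distributions" and \<phi>: "\<phi> \<in> test_functions"
  shows "((\<lambda>\<eta>. fourier_fun \<phi> \<eta> * u (wave \<eta>)) has_sum u \<phi>) UNIV"
proof -
  define c where "c = fourier_fun \<phi>"
  have c: "wsummable s c" for s unfolding c_def by (rule wsummable_fourier_fun_test_function[OF \<phi>])
  have \<phi>c: "\<phi> = fourier_series c"
    unfolding c_def using fourier_inversion[of \<phi>] test_functionsD[OF \<phi>] c[of 0, unfolded c_def] by simp
  obtain C N where CN: "\<And>\<phi>. \<phi> \<in> test_functions \<Longrightarrow>
      norm (u \<phi>) \<le> C * (\<Sum>i\<le>N. \<Sum>j\<le>N. SUP p. norm ((partial_t ^^ i) ((partial_x ^^ j) \<phi>) p))"
    using u unfolding distributions_def by blast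
  \<comment> \<open>At most \<open>N\<close> derivatives fall on each variable, so every seminorm in
    the continuity estimate costs at most the power 2 N of the bracket.\<close>
  define b where "b = (\<lambda>\<eta>. bracket \<eta> powr (2 * real N) * norm (c \<eta>))"
  have b: "b summable_on UNIV" using c by (simp add: b_def wsummable_def)
  define R where "R = (\<lambda>X \<eta>. if \<eta> \<in> X then 0 else c \<eta>)"
  have R: "wsummable s (R X)" for s X
    using c[of s] unfolding wsummable_def by (rule summable_on_comparison_test) (auto simp: R_def)
  have uR: "norm (u (fourier_series (R X))) \<le> \<bar>C\<bar> * real ((N + 1) * (N + 1)) * infsum b (- X)" for X
  proof -
    have "(SUP p. norm ((partial_t ^^ i) ((partial_x ^^ j) (fourier_series (R X))) p)) \<le> infsum b (- X)"
      (is "(SUP p. norm (?f p)) \<le> _") if ij: "i \<le> N" "j \<le> N" for i j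
    proof (rule cSUP_least)
      fix p
      define d where "d = (\<lambda>\<eta>. (\<i> * of_int (fst \<eta>)) ^ i * ((\<i> * of_int (snd \<eta>)) ^ j * R X \<eta>))"
      have d: "norm (d \<eta>) \<le> (if \<eta> \<in> X then 0 else b \<eta>)" for \<eta>
      proof -
        have "norm (d \<eta>) = (\<bar>of_int (fst \<eta>)\<bar> ^ i * \<bar>of_int (snd \<eta>)\<bar> ^ j) * norm (R X \<eta>)"
          by (simp add: d_def norm_mult norm_power)
        also have "\<dots> \<le> (bracket \<eta> ^ N * bracket \<eta> ^ N) * norm (R X \<eta>)"
          by (intro mult_right_mono mult_mono
              order_trans[OF power_mono[OF abs_fst_le_bracket abs_ge_zero] power_increasing[OF ij(1) bracket_ge_1]]
              order_trans[OF power_mono[OF abs_snd_le_bracket abs_ge_zero] power_increasing[OF ij(2) bracket_ge_1]])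
            simp_all
        also have "bracket \<eta> ^ N * bracket \<eta> ^ N = bracket \<eta> powr (2 * real N)"
          using powr_realpow[OF bracket_pos, of \<eta> "N + N"] unfolding power_add by simp
        finally show ?thesis by (auto simp: b_def R_def split: if_splits)
      qed
      have b': "(\<lambda>\<eta>. if \<eta> \<in> X then 0 else b \<eta>) summable_on UNIV"
        using b by (rule summable_on_comparison_test) (auto simp: b_def)
      have "(\<lambda>\<eta>. norm (d \<eta>)) summable_on UNIV"
        using b' by (rule summable_on_comparison_test) (use d in auto)
      then have dw: "wsummable 0 d" by (simp add: wsummable_0_iff)
      have "norm (?f p) \<le> (\<Sum>\<^sub>\<infinity>\<eta>. norm (d \<eta>))"
        using norm_fourier_series_le[OF dw] by (simp add: partials_fourier_series_funpow R d_def)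
      also have "\<dots> \<le> (\<Sum>\<^sub>\<infinity>\<eta>. if \<eta> \<in> X then 0 else b \<eta>)"
        using dw d b' by (intro infsum_mono) (auto simp: wsummable_0_iff)
      also have "\<dots> = infsum b (- X)" by (rule infsum_cong_neutral) auto
      finally show "norm (?f p) \<le> infsum b (- X)" .
    qed simp
    then have "(\<Sum>i\<le>N. \<Sum>j\<le>N. SUP p. norm ((partial_t ^^ i) ((partial_x ^^ j) (fourier_series (R X))) p))
        \<le> (\<Sum>i\<le>N. \<Sum>j\<le>N. infsum b (- X))"
      by (intro sum_mono) auto
    also have "\<dots> = real ((N + 1) * (N + 1)) * infsum b (- X)" by (simp add: algebra_simps)
    finally have le: "(\<Sum>i\<le>N. \<Sum>j\<le>N. SUP p. norm ((partial_t ^^ i) ((partial_x ^^ j) (fourier_series (R X))) p))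
        \<le> real ((N + 1) * (N + 1)) * infsum b (- X)" (is "?S \<le> ?T") .
    \<comment> \<open>\<open>C\<close> carries no sign; since the sum of seminorms is nonnegative,
      its absolute value may replace it.\<close>
    have "?S \<ge> 0"
    proof (intro sum_nonneg)
      fix i j
      obtain B where "\<And>p. norm ((partial_t ^^ i) ((partial_x ^^ j) (fourier_series (R X))) p) \<le> B"
      proof -
        have "(partial_t ^^ i) ((partial_x ^^ j) (fourier_series (R X))) \<in> test_functions"
        proof -
          have "(partial_x ^^ j) (fourier_series (R X)) \<in> test_functions"
            by (induction j) (auto intro: test_functions_partials test_functions_fourier_series R)
          then show ?thesis by (induction i) (auto intro: test_functions_partials)
        qed
        then show thesis using that periodic2_bounded test_functionsD(1,3) by blast
      qed
      then have "bdd_above (range (\<lambda>p. norm ((partial_t ^^ i) ((partial_x ^^ j) (fourier_series (R X))) p)))"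
        by (intro bdd_aboveI2)
      then show "0 \<le> (SUP p. norm ((partial_t ^^ i) ((partial_x ^^ j) (fourier_series (R X))) p))"
        by (rule cSUP_upper2[of _ _ undefined]) simp_all
    qed
    then have "C * ?S \<le> \<bar>C\<bar> * ?S" by (intro mult_right_mono) auto
    also have "\<dots> \<le> \<bar>C\<bar> * ?T" using le by (intro mult_left_mono) auto
    finally show ?thesis
      unfolding mult.assoc[of "\<bar>C\<bar>"]
      by (rule order_trans[OF CN[OF test_functions_fourier_series[OF R]]])
  qed
  have split: "u \<phi> - (\<Sum>\<eta>\<in>X. c \<eta> * u (wave \<eta>)) = u (fourier_series (R X))" if "finite X" for X
  proof -
    have "\<phi> = (\<lambda>p. (\<Sum>\<eta>\<in>X. c \<eta> * wave \<eta> p) + fourier_series (R X) p)"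
      using fourier_series_split[OF c that] \<phi>c by (auto simp: R_def)
    then have "u \<phi> = u (\<lambda>p. (\<Sum>\<eta>\<in>X. c \<eta> * wave \<eta> p) + fourier_series (R X) p)" by simp
    also have "\<dots> = u (\<lambda>p. \<Sum>\<eta>\<in>X. c \<eta> * wave \<eta> p) + u (fourier_series (R X))"
      by (intro distributionsD(2)[OF u] test_functions_sum test_functions_cmult
          wave_test_function test_functions_fourier_series R)
    also have "u (\<lambda>p. \<Sum>\<eta>\<in>X. c \<eta> * wave \<eta> p) = (\<Sum>\<eta>\<in>X. c \<eta> * u (wave \<eta>))"
      by (subst distribution_sum[OF u]) (auto intro!: test_functions_cmult sum.cong distributionsD(3)[OF u])
    finally show ?thesis by simp
  qed
  have "((\<lambda>X. infsum b (- X)) \<longlongrightarrow> 0) (finite_subsets_at_top UNIV)"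
  proof -
    have "((\<lambda>X. infsum b UNIV - sum b X) \<longlongrightarrow> infsum b UNIV - infsum b UNIV) (finite_subsets_at_top UNIV)"
      using b by (intro tendsto_intros infsum_tendsto)
    moreover have "infsum b UNIV - sum b X = infsum b (- X)" if "finite X" for X
      using infsum_Diff[OF b, of X] that by (simp add: Compl_eq_Diff_UNIV)
    then have "\<forall>\<^sub>F X in finite_subsets_at_top UNIV. infsum b UNIV - sum b X = infsum b (- X)"
      by (rule eventually_finite_subsets_at_top_weakI)
    ultimately show ?thesis using Lim_transform_eventually by fastforce
  qed
  then have lim: "((\<lambda>X. \<bar>C\<bar> * real ((N + 1) * (N + 1)) * infsum b (- X)) \<longlongrightarrow> 0) (finite_subsets_at_top UNIV)"
    by (rule tendsto_mult_right_zero)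
  have "((\<lambda>X. (\<Sum>\<eta>\<in>X. c \<eta> * u (wave \<eta>)) - u \<phi>) \<longlongrightarrow> 0) (finite_subsets_at_top UNIV)"
  proof (rule Lim_null_comparison[OF eventually_finite_subsets_at_top_weakI lim])
    fix X :: "(int \<times> int) set" assume "finite X"
    then show "norm ((\<Sum>\<eta>\<in>X. c \<eta> * u (wave \<eta>)) - u \<phi>) \<le> \<bar>C\<bar> * real ((N + 1) * (N + 1)) * infsum b (- X)"
      using split uR[of X] by (metis norm_minus_commute)
  qed
  then show ?thesis unfolding has_sum_def c_def by (rule Lim_null[THEN iffD2])
qed

text \<open>Tested on \<phi>, both sides are the sum of the same family, once by Parseval's identity
  and once by expanding \<phi>. The reflection of \<eta> accounts for the sign in
  \<open>fourier_coeff_eq\<close>.\<close>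

lemma distribution_eq_distr_of_fourier_series:
  assumes u: "u \<in> distributions" and w: "wsummable 0 (fourier_coeff u)"
  shows "u = distr_of (fourier_series (fourier_coeff u))"
proof (rule distribution_eqI)
  show "u \<in> extensional test_functions" by (rule distributionsD(1)[OF u])
  show "distr_of (fourier_series (fourier_coeff u)) \<in> extensional test_functions"
    by (rule distr_of_extensional)
  fix \<phi> assume \<phi>: "\<phi> \<in> test_functions"
  have "((\<lambda>\<eta>. 4 * pi\<^sup>2 * (fourier_coeff u \<eta> * fourier_fun \<phi> (- \<eta>))) has_sum
      distr_of (fourier_series (fourier_coeff u)) \<phi>) UNIV"
    unfolding distr_of_apply[OF \<phi>]
    by (intro has_sum_integral_fourier_series_mult w test_functionsD[OF \<phi>])
  moreover have "((\<lambda>\<eta>. 4 * pi\<^sup>2 * (fourier_coeff u \<eta> * fourier_fun \<phi> (- \<eta>))) has_sum u \<phi>) UNIV"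
  proof -
    have "bij_betw uminus (UNIV :: (int \<times> int) set) UNIV"
      by (rule bij_betwI[of _ _ _ uminus]) auto
    from has_sum_reindex_bij_betw[OF this, THEN iffD2, OF distribution_has_sum[OF u \<phi>]]
    show ?thesis by (simp add: fourier_coeff_eq mult_ac)
  qed
  ultimately show "u \<phi> = distr_of (fourier_series (fourier_coeff u)) \<phi>"
    by (rule has_sum_unique[rotated])
qed

lemma distr_of_sobolev:
  assumes "periodic2 g" "cont_diff n g"
  shows "distr_of g \<in> sobolev (real n)"
  using summable_on_fourier_fun_cont_diff[OF assms(2,1)] assms cont_diff_imp_continuous_on
  by (auto simp: sobolev_def fourier_coeff_distr_of distr_of_distribution)

subsection \<open>Small divisors\<close>

text \<open>Rounding q \<alpha> down gives an error below 1 / q for every q, so the exponent 1 is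
  always admissible. This makes the growth exponent \<nu> - 1 of the single-frequency solutions
  nonnegative.\<close>

lemma irrationality_measure_ge_1: "1 \<le> irrationality_measure \<alpha>"
proof -
  let ?S = "{(p :: int, q :: nat). 0 < q \<and> \<bar>\<alpha> - of_int p / of_nat q\<bar> < of_nat q powr (- 1)}"
  have "(\<lfloor>real (Suc n) * \<alpha>\<rfloor>, Suc n) \<in> ?S" for n
  proof -
    define q where "q = real (Suc n)"
    have q: "q > 0" by (simp add: q_def)
    have "\<alpha> - of_int \<lfloor>q * \<alpha>\<rfloor> / q = frac (q * \<alpha>) / q"
      using q by (simp add: frac_def field_simps)
    then have "\<bar>\<alpha> - of_int \<lfloor>q * \<alpha>\<rfloor> / q\<bar> < q powr (- 1)"
      using q frac_lt_1[of "q * \<alpha>"] by (simp add: powr_minus divide_simps)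
    then show ?thesis by (simp add: q_def)
  qed
  then have "range (\<lambda>n. (\<lfloor>real (Suc n) * \<alpha>\<rfloor>, Suc n)) \<subseteq> ?S" by blast
  moreover have "infinite (range (\<lambda>n. (\<lfloor>real (Suc n) * \<alpha>\<rfloor>, Suc n)))"
    by (rule range_inj_infinite) (simp add: inj_def)
  ultimately have "infinite ?S" using finite_subset by blast
  then have "ereal 1 \<in> {ereal \<nu> | \<nu>. 0 < \<nu> \<and>
     infinite {(p :: int, q :: nat). 0 < q \<and> \<bar>\<alpha> - of_int p / of_nat q\<bar> < of_nat q powr (- \<nu>)}}"
    by force
  then show ?thesis unfolding irrationality_measure_def one_ereal_def by (rule Sup_upper)
qed

text \<open>Beyond the irrationality measure only finitely many pairs are exceptionally close. The
  others satisfy the bound with constant 1, and on the finite set irrationality keeps every distance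
  positive, so a minimum serves. Clearing the denominator turns the exponent - \<nu> into 1 -
  \<nu>.\<close>

lemma irrationality_measure_lower_bound:
  assumes \<alpha>: "\<alpha> \<notin> \<rat>" and \<nu>: "irrationality_measure \<alpha> < ereal \<nu>"
  obtains c where "c > 0" "\<And>(p :: int) (q :: nat). q > 0 \<Longrightarrow> c * real q powr (1 - \<nu>) \<le> \<bar>real q * \<alpha> - of_int p\<bar>"
proof -
  define S where "S = {(p :: int, q :: nat). 0 < q \<and> \<bar>\<alpha> - of_int p / of_nat q\<bar> < of_nat q powr (- \<nu>)}"
  have "ereal 1 < ereal \<nu>"
    using irrationality_measure_ge_1[of \<alpha>] \<nu> unfolding one_ereal_def by (rule le_less_trans)
  then have "\<nu> > 0" by simp
  have "finite S"
  proof (rule ccontr)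
    assume "infinite S"
    then have "ereal \<nu> \<le> irrationality_measure \<alpha>"
      unfolding irrationality_measure_def S_def using \<open>\<nu> > 0\<close> by (intro Sup_upper) blast
    with \<nu> show False by simp
  qed
  define h where "h = (\<lambda>(p :: int, q :: nat). \<bar>real q * \<alpha> - of_int p\<bar> * real q powr (\<nu> - 1))"
  \<comment> \<open>Inserting 1 makes the minimum meaningful when \<open>S\<close> is empty and
    gives \<open>c \<le> 1\<close> for the pairs outside \<open>S\<close>.\<close>
  define c where "c = Min (insert 1 (h ` S))"
  have pos: "\<bar>real q * \<alpha> - of_int p\<bar> > 0" if "q > 0" for p :: int and q :: nat
  proof -
    have "\<alpha> \<noteq> of_int p / of_nat q" using \<alpha> by auto
    then show ?thesis using that by (simp add: field_simps)
  qed
  have "c > 0"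
    unfolding c_def using \<open>finite S\<close> pos by (auto simp: h_def S_def intro!: mult_pos_pos)
  moreover have "c * real q powr (1 - \<nu>) \<le> \<bar>real q * \<alpha> - of_int p\<bar>" if q: "q > 0" for p :: int and q :: nat
  proof (cases "(p, q) \<in> S")
    case True
    have "c * real q powr (1 - \<nu>) \<le> h (p, q) * real q powr (1 - \<nu>)"
      using True \<open>finite S\<close> by (intro mult_right_mono) (auto simp: c_def)
    also have "\<dots> = \<bar>real q * \<alpha> - of_int p\<bar> * (real q powr (\<nu> - 1) * real q powr (1 - \<nu>))"
      by (simp add: h_def)
    also have "real q powr (\<nu> - 1) * real q powr (1 - \<nu>) = 1"
      using q by (simp flip: powr_add)
    finally show ?thesis by simp
  next
    case False
    have "c \<le> 1" using \<open>finite S\<close> by (simp add: c_def)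
    then have "c * real q powr (1 - \<nu>) \<le> real q powr (1 - \<nu>)" by (simp add: mult_left_le_one_le \<open>c > 0\<close> less_imp_le)
    also have "\<dots> = real q * real q powr (- \<nu>)"
      using q powr_add[of "real q" 1 "- \<nu>"] by simp
    also have "\<dots> \<le> real q * \<bar>\<alpha> - of_int p / of_nat q\<bar>"
      using False q by (intro mult_left_mono) (auto simp: S_def)
    also have "\<dots> = \<bar>real q * (\<alpha> - of_int p / of_nat q)\<bar>" by (simp add: abs_mult)
    also have "real q * (\<alpha> - of_int p / of_nat q) = real q * \<alpha> - of_int p" using q by (simp add: field_simps)
    finally show ?thesis .
  qed
  ultimately show thesis by (rule that)
qed

text \<open>The double angle formula and the mean value theorem give sin x = x cos z cos (x / 2)
  with both angles at most pi / 4, so each cosine is at least sqrt 2 / 2.\<close>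

lemma sin_ge_half:
  assumes "0 \<le> x" "x \<le> pi / 2"
  shows "x / 2 \<le> sin x"
proof (cases "x = 0")
  case False
  then obtain z where z: "0 < z" "z < x / 2" "sin (x / 2) - sin 0 = (x / 2 - 0) * cos z"
    using MVT2[of 0 "x / 2" sin cos] assms by (auto intro: DERIV_sin)
  have c: "sqrt 2 / 2 \<le> cos y" if "0 \<le> y" "y \<le> pi / 4" for y
    using cos_monotone_0_pi_le[OF that] by (simp add: cos_45)
  have "x / 2 = x * ((sqrt 2 / 2) * (sqrt 2 / 2))" by simp
  also have "\<dots> \<le> x * (cos z * cos (x / 2))"
    using z assms by (intro mult_left_mono mult_mono c) (auto intro: order_trans[OF _ c])
  also have "\<dots> = 2 * sin (x / 2) * cos (x / 2)" using z(3) by simp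
  also have "\<dots> = sin x" using sin_double[of "x / 2"] by simp
  finally show ?thesis .
qed simp

lemma norm_exp_minus_1_ge:
  assumes "\<bar>y\<bar> \<le> pi"
  shows "\<bar>y\<bar> / 2 \<le> norm (exp (\<i> * of_real y) - 1)"
proof -
  have "norm (exp (\<i> * of_real y) - 1) = 2 * \<bar>sin (y / 2)\<bar>" by (rule dist_exp_i_1)
  also have "\<bar>sin (y / 2)\<bar> = \<bar>sin (\<bar>y\<bar> / 2)\<bar>" by (auto simp: abs_if)
  finally show ?thesis using sin_ge_half[of "\<bar>y\<bar> / 2"] assms by auto
qed

text \<open>The divisor is a chord of the unit circle, bounded below by a multiple of the distance
  from \<alpha> m to the nearest integer, to which the Diophantine bound applies.\<close>

lemma small_divisor_bound:
  assumes \<alpha>: "\<alpha> \<notin> \<rat>" and \<nu>: "irrationality_measure \<alpha> < ereal \<nu>"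
  obtains c where "c > 0"
    "\<And>m :: int. m \<noteq> 0 \<Longrightarrow> c * \<bar>of_int m\<bar> powr (1 - \<nu>) \<le> norm (exp (\<i> * of_real (2 * pi * \<alpha> * of_int m)) - 1)"
proof -
  obtain c where c: "c > 0" "\<And>(p :: int) (q :: nat). q > 0 \<Longrightarrow> c * real q powr (1 - \<nu>) \<le> \<bar>real q * \<alpha> - of_int p\<bar>"
    using irrationality_measure_lower_bound[OF assms] by blast
  have "(pi * c) * \<bar>of_int m\<bar> powr (1 - \<nu>) \<le> norm (exp (\<i> * of_real (2 * pi * \<alpha> * of_int m)) - 1)"
    if "m \<noteq> 0" for m :: int
  proof -
    \<comment> \<open>Removing the nearest integer brings the angle into [-pi, pi], where the chord
      bound is valid.\<close>
    define p where "p = round (\<alpha> * of_int m)"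
    define y where "y = 2 * pi * (\<alpha> * of_int m - of_int p)"
    have "\<bar>\<alpha> * of_int m - of_int p\<bar> \<le> 1 / 2"
      using of_int_round_abs_le[of "\<alpha> * of_int m"] by (simp add: p_def abs_minus_commute)
    then have y: "\<bar>y\<bar> \<le> pi" by (simp add: y_def abs_mult)
    \<comment> \<open>Denominators are positive naturals, so |m| takes that role and the sign of
      \<open>m\<close> moves to the numerator.\<close>
    have "c * real (nat \<bar>m\<bar>) powr (1 - \<nu>) \<le> \<bar>real (nat \<bar>m\<bar>) * \<alpha> - of_int (sgn m * p)\<bar>"
      using that by (intro c) simp
    also have "real (nat \<bar>m\<bar>) * \<alpha> - of_int (sgn m * p) = of_int (sgn m) * (\<alpha> * of_int m - of_int p)"
      by (cases "m > 0") (use that in \<open>auto simp: sgn_if algebra_simps\<close>)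
    also have "\<bar>\<dots>\<bar> = \<bar>\<alpha> * of_int m - of_int p\<bar>"
      using that by (auto simp: abs_mult sgn_if)
    finally have "pi * (c * \<bar>of_int m\<bar> powr (1 - \<nu>)) \<le> pi * \<bar>\<alpha> * of_int m - of_int p\<bar>"
      by (intro mult_left_mono) auto
    also have "\<dots> = \<bar>y\<bar> / 2" by (simp add: y_def abs_mult)
    also have "\<dots> \<le> norm (exp (\<i> * of_real y) - 1)" by (rule norm_exp_minus_1_ge[OF y])
    also have "exp (\<i> * of_real y) = exp (\<i> * of_real (2 * pi * \<alpha> * of_int m))"
    proof -
      have "exp (\<i> * of_real (2 * pi * \<alpha> * of_int m)) = exp (\<i> * of_real y) * exp (of_int p * (of_real (2 * pi) * \<i>))"
        unfolding exp_add[symmetric] by (rule arg_cong[of _ _ exp]) (simp add: y_def algebra_simps)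
      then show ?thesis using exp_integer_2pi[of "of_int p"] by (simp add: mult_ac)
    qed
    finally show ?thesis by (simp add: mult_ac)
  qed
  moreover have "pi * c > 0" using c by simp
  ultimately show thesis using that by blast
qed

subsection \<open>Periodic solutions on a single frequency\<close>

lemma continuous_antiderivative:
  fixes f :: "real \<Rightarrow> 'a::euclidean_space"
  assumes "\<And>t. isCont f t"
  obtains F where "\<And>t. (F has_vector_derivative f t) (at t)" "F 0 = 0"
proof -
  obtain G where G: "\<And>t. (G has_vector_derivative f t) (at t)"
    using einterval_antiderivative[of "-\<infinity>" \<infinity> f] assms by auto
  then have "((\<lambda>t. G t - G 0) has_vector_derivative f t) (at t)" for t
    by (auto intro!: derivative_eq_intros)
  then show thesis using that[of "\<lambda>t. G t - G 0"] by simp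
qed

lemma zero_vector_derivative_const:
  fixes f :: "real \<Rightarrow> 'a::real_normed_vector"
  assumes "\<And>t. (f has_vector_derivative 0) (at t)"
  shows "f s = f t"
  using has_vector_derivative_zero_constant[of UNIV f] assms by fastforce

lemma has_vector_derivative_shift:
  assumes "\<And>t. (f has_vector_derivative f' t) (at t)"
  shows "((\<lambda>t. f (t + c)) has_vector_derivative f' (t + c)) (at t)"
proof -
  have "((\<lambda>t. t + c) has_vector_derivative 1) (at t)" by (auto intro!: derivative_eq_intros)
  from vector_diff_chain_at[OF this assms] show ?thesis by (simp add: o_def)
qed

text \<open>Variation of constants. \<open>g\<close> is the forcing divided by the homogeneous
  solution exp (i m A). One period divides it by \<theta>, so its primitive \<open>J\<close> changes
  affinely under the shift, and \<theta> \<noteq> 1 lets an additive constant restore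
  periodicity.\<close>

lemma periodic_resonance_free_ode:
  fixes a A :: "real \<Rightarrow> real" and m n :: int
  assumes A: "\<And>t. (A has_vector_derivative a t) (at t)" "\<And>t. A (t + 2 * pi) = A t + 2 * pi * \<alpha>"
    and \<theta>: "exp (\<i> * of_real (2 * pi * \<alpha> * of_int m)) \<noteq> 1"
  obtains w where
    "\<And>t. (w has_vector_derivative (\<i> * of_int m * of_real (a t) * w t + exp (\<i> * of_real (of_int n * t)))) (at t)"
    "\<And>t. w (t + 2 * pi) = w t"
    "\<And>t. norm (w t) \<le> 2 * pi * (1 + 1 / norm (exp (\<i> * of_real (2 * pi * \<alpha> * of_int m)) - 1))"
proof -
  define \<theta> where "\<theta> = exp (\<i> * of_real (2 * pi * \<alpha> * of_int m))"
  have \<theta>: "\<theta> \<noteq> 1" "norm \<theta> = 1" using assms(3) by (auto simp: \<theta>_def simp del: of_real_mult)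
  then have "\<theta> \<noteq> 0" by auto
  define g where "g = (\<lambda>t. exp (\<i> * of_real (of_int n * t - of_int m * A t)))"
  have A_cont: "isCont A t" for t
    using A(1) has_vector_derivative_continuous by blast
  have g_cont: "isCont g t" for t unfolding g_def by (intro continuous_intros A_cont)
  have g_norm: "norm (g t) = 1" for t by (simp add: g_def del: of_real_diff of_real_mult)
  have g_shift: "g (t + 2 * pi) = g t / \<theta>" for t
  proof -
    have "g (t + 2 * pi) = exp (\<i> * of_real (of_int n * t - of_int m * A t)
        + of_int n * (of_real (2 * pi) * \<i>) - \<i> * of_real (2 * pi * \<alpha> * of_int m))"
      unfolding g_def A(2) by (rule arg_cong[of _ _ exp]) (simp add: algebra_simps)
    also have "\<dots> = g t / \<theta> * exp (of_int n * (of_real (2 * pi) * \<i>))"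
      by (simp add: g_def \<theta>_def exp_add exp_diff)
    finally show ?thesis using exp_integer_2pi[of "of_int n"] by (simp add: mult_ac)
  qed
  obtain J where J: "\<And>t. (J has_vector_derivative g t) (at t)" "J 0 = 0"
    using continuous_antiderivative[of g] g_cont by blast
  have J_shift: "J (t + 2 * pi) = J (2 * pi) + J t / \<theta>" for t
  proof -
    have "((\<lambda>t. J (t + 2 * pi) - J t / \<theta>) has_vector_derivative 0) (at t)" for t
      using has_vector_derivative_shift[OF J(1), of "2 * pi" t] J(1)[of t]
      by (auto intro!: derivative_eq_intros simp: g_shift)
    from zero_vector_derivative_const[OF this, of t 0]
    show ?thesis by (simp add: J(2) algebra_simps)
  qed
  have J_norm: "norm (J t) \<le> 2 * pi" if "t \<in> {0..2 * pi}" for t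
  proof -
    have "(g has_integral (J t - J 0)) {0..t}"
      using that by (intro fundamental_theorem_of_calculus) (auto intro: has_vector_derivative_at_within J)
    then have "norm (J t) \<le> 1 * (t - 0)"
      using integral_bound[of 0 t g 1] that g_norm g_cont J(2)
      by (auto simp: integral_unique intro!: continuous_at_imp_continuous_on)
    then show ?thesis using that by simp
  qed
  \<comment> \<open>The requirement w (2 pi) = w 0 reads \<theta> (C + J (2 pi)) = C; solving it for
    \<open>C\<close> is where the small divisor enters.\<close>
  define C where "C = \<theta> * J (2 * pi) / (1 - \<theta>)"
  have C: "\<theta> * (C + J (2 * pi)) = C" using \<theta>(1) by (simp add: C_def field_simps)
  define w where "w = (\<lambda>t. exp (\<i> * of_real (of_int m * A t)) * (C + J t))"
  have w': "(w has_vector_derivative (\<i> * of_int m * of_real (a t) * w t + exp (\<i> * of_real (of_int n * t)))) (at t)" for t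
  proof -
    have "((\<lambda>t. \<i> * of_real (of_int m * A t)) has_vector_derivative \<i> * of_real (of_int m * a t)) (at t)"
      by (intro has_vector_derivative_mult_right has_vector_derivative_of_real DERIV_cmult
          A(1)[folded has_real_derivative_iff_has_vector_derivative])
    from field_vector_diff_chain_at[OF this DERIV_exp]
    have "((\<lambda>t. exp (\<i> * of_real (of_int m * A t))) has_vector_derivative
        \<i> * of_real (of_int m * a t) * exp (\<i> * of_real (of_int m * A t))) (at t)"
      by (simp add: o_def)
    moreover have "((\<lambda>t. C + J t) has_vector_derivative g t) (at t)"
      using J(1) by (auto intro!: derivative_eq_intros)
    ultimately have "(w has_vector_derivative exp (\<i> * of_real (of_int m * A t)) * g t
        + \<i> * of_real (of_int m * a t) * exp (\<i> * of_real (of_int m * A t)) * (C + J t)) (at t)"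
      unfolding w_def by (rule has_vector_derivative_mult)
    moreover have "exp (\<i> * of_real (of_int m * A t)) * g t = exp (\<i> * of_real (of_int n * t))"
      unfolding g_def exp_add[symmetric] by (rule arg_cong[of _ _ exp]) (simp add: algebra_simps)
    ultimately show ?thesis by (simp add: w_def mult_ac add.commute)
  qed
  have w_shift: "w (t + 2 * pi) = w t" for t
  proof -
    have "exp (\<i> * of_real (of_int m * A (t + 2 * pi))) = exp (\<i> * of_real (of_int m * A t)) * \<theta>"
      unfolding \<theta>_def A(2) exp_add[symmetric] by (rule arg_cong[of _ _ exp]) (simp add: algebra_simps)
    then have "w (t + 2 * pi) = exp (\<i> * of_real (of_int m * A t)) * (\<theta> * (C + J (2 * pi)) + \<theta> * (J t / \<theta>))"
      unfolding w_def J_shift by (simp only: distrib_left mult.assoc add.assoc)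
    then show ?thesis using \<open>\<theta> \<noteq> 0\<close> by (simp add: C w_def)
  qed
  have "norm (w t) \<le> 2 * pi * (1 + 1 / norm (\<theta> - 1))" for t
  proof -
    have le: "norm (w t) \<le> 2 * pi * (1 + 1 / norm (\<theta> - 1))" if "t \<in> {0..2 * pi}" for t
    proof -
      have "norm (w t) \<le> norm C + norm (J t)"
        unfolding w_def norm_mult using norm_triangle_ineq[of C "J t"] by (simp del: of_real_mult)
      also have "norm C = norm (J (2 * pi)) / norm (\<theta> - 1)"
        by (simp add: C_def norm_mult norm_divide \<theta> norm_minus_commute)
      also have "\<dots> \<le> 2 * pi / norm (\<theta> - 1)" by (intro divide_right_mono J_norm) auto
      finally show ?thesis using J_norm[OF that] by (simp add: algebra_simps)
    qed
    \<comment> \<open>\<open>w\<close> is viewed as a function on the torus that is constant in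
      \<open>x\<close>, so that the reduction of points to one period carries the bound to all
      t.\<close>
    obtain q where q: "q \<in> torus" "\<forall>g :: real \<times> real \<Rightarrow> complex. periodic2 g \<longrightarrow> g q = g (t, 0)"
      by (rule periodic2_torus_representative)
    have "periodic2 (\<lambda>p. w (fst p))" using w_shift by (simp add: periodic2_def)
    from q(2)[rule_format, OF this] have "w (fst q) = w t" by simp
    moreover have "fst q \<in> {0..2 * pi}" using q(1) by (cases q) auto
    ultimately show ?thesis using le by metis
  qed
  then show thesis using that[of w] w' w_shift unfolding \<theta>_def by blast
qed

subsection \<open>The transport operator\<close>

lemma smooth_circleD:
  assumes "a \<in> smooth_circle"
  shows "a (t + 2 * pi) = a t" "(a has_vector_derivative deriv a t) (at t)" "isCont a t"
    "(\<lambda>p. complex_of_real (a (fst p))) \<in> test_functions"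
proof -
  show "a (t + 2 * pi) = a t" using assms by (simp add: smooth_circle_def periodic1_def)
  have d: "(deriv ^^ n) a differentiable (at t)" for n t using assms by (simp add: smooth_circle_def)
  from d[of 0] show "(a has_vector_derivative deriv a t) (at t)"
    by (simp add: DERIV_deriv_iff_real_differentiable flip: has_real_derivative_iff_has_vector_derivative)
  then show "isCont a t" by (rule has_vector_derivative_continuous)
  show "(\<lambda>p. complex_of_real (a (fst p))) \<in> test_functions"
    using assms cont_diff_of_real_fst[OF d]
    by (simp add: test_functions_def smooth_circle_def periodic1_def periodic2_def case_prod_unfold)
qed

lemma has_partials_fst:
  assumes "\<And>t. (w has_vector_derivative w' t) (at t)"
  shows "has_partials (\<lambda>p. w (fst p)) (\<lambda>p. w' (fst p)) (\<lambda>p. 0)"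
  unfolding has_partials_def
proof
  fix p :: "real \<times> real"
  show "((\<lambda>p. w (fst p)) has_derivative (\<lambda>h. fst h *\<^sub>R w' (fst p) + snd h *\<^sub>R 0)) (at p)"
    using has_derivative_compose[OF bounded_linear_imp_has_derivative[OF bounded_linear_fst],
        of w "\<lambda>h. h *\<^sub>R w' (fst p)" p UNIV] assms
    by (simp add: has_vector_derivative_def)
qed

text \<open>As the coefficient depends on \<open>t\<close> only, \<open>\<partial>\<^sub>t - a(t) \<partial>\<^sub>x\<close> is minus its own transpose.\<close>

definition transport :: "(real \<Rightarrow> real) \<Rightarrow> (real \<times> real \<Rightarrow> complex) \<Rightarrow> real \<times> real \<Rightarrow> complex" where
  "transport a \<phi> = (\<lambda>p. partial_t \<phi> p + (- 1) * (of_real (a (fst p)) * partial_x \<phi> p))"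

lemma partial_x_fst_mult:
  assumes "a \<in> smooth_circle" "\<phi> \<in> test_functions"
  shows "partial_x (\<lambda>p. of_real (a (fst p)) * \<phi> p) = (\<lambda>p. of_real (a (fst p)) * partial_x \<phi> p)"
proof -
  have "((\<lambda>t. complex_of_real (a t)) has_vector_derivative of_real (deriv a t)) (at t)" for t
    using smooth_circleD(2)[OF assms(1), of t]
    by (auto intro!: has_vector_derivative_of_real simp flip: has_real_derivative_iff_has_vector_derivative)
  from has_partials_imp_eq(2)[OF has_partials_mult[OF has_partials_fst[OF this] test_functionsD(4)[OF assms(2)]]]
  show ?thesis by simp
qed

lemma transport_test_function:
  assumes "a \<in> smooth_circle" "\<phi> \<in> test_functions"
  shows "transport a \<phi> \<in> test_functions"
  unfolding transport_def
  by (intro test_functions_add test_functions_cmult test_functions_mult smooth_circleD[OF assms(1)]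
      test_functions_partials assms)

text \<open>Because \<open>a\<close> does not depend on \<open>x\<close>, it passes through
  \<open>partial_x\<close>; the signs of the two distributional derivatives then combine into one
  overall minus.\<close>

lemma vector_field_op_apply:
  assumes a: "a \<in> smooth_circle" and u: "u \<in> distributions" and \<phi>: "\<phi> \<in> test_functions"
  shows "vector_field_op a u \<phi> = - u (transport a \<phi>)"
proof -
  have a\<phi>: "(\<lambda>p. of_real (a (fst p)) * \<phi> p) \<in> test_functions"
    by (intro test_functions_mult smooth_circleD[OF a] \<phi>)
  have a\<phi>x: "(\<lambda>p. of_real (a (fst p)) * partial_x \<phi> p) \<in> test_functions"
    by (intro test_functions_mult smooth_circleD[OF a] test_functions_partials \<phi>)
  have "vector_field_op a u \<phi> = - u (partial_t \<phi>) + u (\<lambda>p. of_real (a (fst p)) * partial_x \<phi> p)"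
    using a\<phi> \<phi> by (simp add: vector_field_op_def distr_dt_def distr_mult_def distr_dx_def case_prod_unfold
        partial_x_fst_mult[OF a \<phi>])
  moreover have "u (transport a \<phi>) = u (partial_t \<phi>) + (- 1) * u (\<lambda>p. of_real (a (fst p)) * partial_x \<phi> p)"
    unfolding transport_def distributionsD(3)[OF u a\<phi>x, symmetric]
    by (rule distributionsD(2)[OF u test_functions_partials(1)[OF \<phi>] test_functions_cmult[OF a\<phi>x]])
  ultimately show ?thesis by simp
qed

lemma integral_torus_transport:
  assumes a: "a \<in> smooth_circle" and \<phi>: "\<phi> \<in> test_functions"
    and g: "has_partials g gt gx" "periodic2 g" "continuous_on UNIV gt" "continuous_on UNIV gx"
  shows "integral torus (\<lambda>p. g p * transport a \<phi> p)
    = - integral torus (\<lambda>p. (gt p - of_real (a (fst p)) * gx p) * \<phi> p)"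
proof -
  let ?a = "\<lambda>p. complex_of_real (a (fst p))"
  have a\<phi>: "(\<lambda>p. ?a p * \<phi> p) \<in> test_functions"
    by (intro test_functions_mult smooth_circleD[OF a] \<phi>)
  note ca = test_functionsD(3)[OF smooth_circleD(4)[OF a], of UNIV]
  note cg = has_partials_imp_continuous_on[OF g(1), of UNIV]
  note c\<phi> = test_functionsD(3)[OF \<phi>, of UNIV]
    test_functionsD(3)[OF test_functions_partials(1)[OF \<phi>], of UNIV]
    test_functionsD(3)[OF test_functions_partials(2)[OF \<phi>], of UNIV]
  note bp = integral_torus_by_parts[OF g test_functionsD(4,1) test_functionsD(3)[OF test_functions_partials(1)]
      test_functionsD(3)[OF test_functions_partials(2)]]
  have "integral torus (\<lambda>p. g p * transport a \<phi> p)
      = integral torus (\<lambda>p. g p * partial_t \<phi> p) - integral torus (\<lambda>p. g p * (?a p * partial_x \<phi> p))"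
    by (subst integral_torus_diff[symmetric])
      (auto intro!: continuous_intros cg ca c\<phi> simp: transport_def algebra_simps)
  also have "\<dots> = - integral torus (\<lambda>p. gt p * \<phi> p) + integral torus (\<lambda>p. gx p * (?a p * \<phi> p))"
    using bp(1)[OF \<phi> \<phi> \<phi> \<phi>] bp(2)[OF a\<phi> a\<phi> a\<phi> a\<phi>] by (simp add: partial_x_fst_mult[OF a \<phi>])
  also have "\<dots> = - (integral torus (\<lambda>p. gt p * \<phi> p) - integral torus (\<lambda>p. gx p * (?a p * \<phi> p)))" by simp
  also have "\<dots> = - integral torus (\<lambda>p. gt p * \<phi> p - gx p * (?a p * \<phi> p))"
    by (subst integral_torus_diff) (auto intro!: continuous_intros g(3,4) ca c\<phi>)
  also have "(\<lambda>p. gt p * \<phi> p - gx p * (?a p * \<phi> p)) = (\<lambda>p. (gt p - ?a p * gx p) * \<phi> p)"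
    by (simp add: fun_eq_iff algebra_simps)
  finally show ?thesis .
qed

text \<open>For second component 0 the divisor vanishes, but the \<open>x\<close>-derivative drops
  out and the character divided by i \<tau> is a solution. All other frequencies use the ODE and the
  small divisor bound. The assumption \<open>1 \<le> \<nu>\<close> makes the weight at least 1, so
  one estimate covers both cases.\<close>

lemma transport_frequency_solution:
  assumes a: "a \<in> smooth_circle" and \<alpha>: "mean_circle a \<notin> \<rat>"
    and \<nu>: "irrationality_measure (mean_circle a) < ereal \<nu>" "1 \<le> \<nu>"
  obtains K where "\<And>\<eta>. \<eta> \<noteq> 0 \<Longrightarrow> \<exists>e. periodic2 e \<and>
      has_partials e (\<lambda>p. of_real (a (fst p)) * (\<i> * of_int (snd \<eta>) * e p) + wave \<eta> p)
        (\<lambda>p. \<i> * of_int (snd \<eta>) * e p) \<and>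
      (\<forall>p. norm (e p) \<le> K * bracket \<eta> powr (\<nu> - 1))"
proof -
  define \<alpha> where "\<alpha> = mean_circle a"
  obtain c where c: "c > 0"
    "\<And>m :: int. m \<noteq> 0 \<Longrightarrow> c * \<bar>of_int m\<bar> powr (1 - \<nu>) \<le> norm (exp (\<i> * of_real (2 * pi * \<alpha> * of_int m)) - 1)"
    using small_divisor_bound[OF \<open>mean_circle a \<notin> \<rat>\<close> \<nu>(1)] unfolding \<alpha>_def by blast
  obtain A where A: "\<And>t. (A has_vector_derivative a t) (at t)"
    using continuous_antiderivative[of a] smooth_circleD(3)[OF a] by blast
  have A_shift: "A (t + 2 * pi) = A t + 2 * pi * \<alpha>" for t
  proof -
    have "((\<lambda>t. A (t + 2 * pi) - A t) has_vector_derivative 0) (at t)" for t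
      using has_vector_derivative_shift[OF A, of "2 * pi" t] A[of t] smooth_circleD(1)[OF a]
      by (auto intro!: derivative_eq_intros)
    then have "A (t + 2 * pi) - A t = A (0 + 2 * pi) - A 0" by (rule zero_vector_derivative_const)
    moreover have "(a has_integral (A (2 * pi) - A 0)) {0..2 * pi}"
      by (intro fundamental_theorem_of_calculus) (auto intro: has_vector_derivative_at_within A)
    then have "A (2 * pi) - A 0 = 2 * pi * \<alpha>" by (simp add: \<alpha>_def mean_circle_def integral_unique)
    ultimately show ?thesis by simp
  qed
  \<comment> \<open>The factor 2 pi is the length of a period; the summand 1 comes from the
    primitive of the forcing and 1 / c from the divisor.\<close>
  define K where "K = 2 * pi * (1 + 1 / c)"
  have K: "K \<ge> 1" using pi_ge_two c(1) by (simp add: K_def) (smt (verit) mult_ge1_I zero_le_divide_1_iff)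
  have "\<exists>e. periodic2 e \<and>
      has_partials e (\<lambda>p. of_real (a (fst p)) * (\<i> * of_int (snd \<eta>) * e p) + wave \<eta> p)
        (\<lambda>p. \<i> * of_int (snd \<eta>) * e p) \<and>
      (\<forall>p. norm (e p) \<le> K * bracket \<eta> powr (\<nu> - 1))" if "\<eta> \<noteq> 0" for \<eta> :: "int \<times> int"
  proof (cases "snd \<eta> = 0")
    case True
    define b where "b = 1 / (\<i> * of_int (fst \<eta>))"
    have "fst \<eta> \<noteq> 0" using True that by (auto simp: prod_eq_iff)
    then have b: "b * (\<i> * of_int (fst \<eta>)) = 1" by (simp add: b_def)
    have "1 \<le> \<bar>real_of_int (fst \<eta>)\<bar>" using \<open>fst \<eta> \<noteq> 0\<close> by linarith
    then have b1: "norm b \<le> 1" by (simp add: b_def norm_mult norm_divide)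
    have "1 \<le> bracket \<eta> powr (\<nu> - 1)" using \<nu>(2) by (intro ge_one_powr_ge_zero bracket_ge_1) simp
    with K b1 have "norm b \<le> K * bracket \<eta> powr (\<nu> - 1)" by (smt (verit) mult_ge1_I)
    moreover have "has_partials (\<lambda>p. b * wave \<eta> p) (\<lambda>p. wave \<eta> p) (\<lambda>p. 0)"
      using has_partials_cmult[OF has_partials_wave, of b \<eta>] b True by (simp flip: mult.assoc)
    ultimately show ?thesis
      using periodic2_wave[of \<eta>] True
      by (intro exI[of _ "\<lambda>p. b * wave \<eta> p"]) (simp add: norm_mult periodic2_def)
  next
    case False
    define \<theta> where "\<theta> = exp (\<i> * of_real (2 * pi * \<alpha> * of_int (snd \<eta>)))"
    define r where "r = \<bar>real_of_int (snd \<eta>)\<bar>"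
    have r: "1 \<le> r" using False by (simp add: r_def)
    have cr: "c * r powr (1 - \<nu>) \<le> norm (\<theta> - 1)" using c(2)[OF False] by (simp add: \<theta>_def r_def)
    have cr0: "c * r powr (1 - \<nu>) > 0" using c(1) r by simp
    then have "\<theta> \<noteq> 1" using cr by auto
    then obtain w where w:
      "\<And>t. (w has_vector_derivative (\<i> * of_int (snd \<eta>) * of_real (a t) * w t + exp (\<i> * of_real (of_int (fst \<eta>) * t)))) (at t)"
      "\<And>t. w (t + 2 * pi) = w t"
      "\<And>t. norm (w t) \<le> 2 * pi * (1 + 1 / norm (\<theta> - 1))"
      using periodic_resonance_free_ode[OF A A_shift, of "snd \<eta>" "fst \<eta>"] unfolding \<theta>_def by blast
    define e where "e = (\<lambda>p. w (fst p) * wave (0, snd \<eta>) p)"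
    have wave: "exp (\<i> * of_real (of_int (fst \<eta>) * fst p)) * wave (0, snd \<eta>) p = wave \<eta> p" for p
      unfolding wave_def exp_add[symmetric] by (rule arg_cong[of _ _ exp]) (simp add: algebra_simps)
    have "norm (e p) \<le> K * bracket \<eta> powr (\<nu> - 1)" for p
    proof -
      have "1 / norm (\<theta> - 1) \<le> 1 / (c * r powr (1 - \<nu>))" using cr cr0
        by (intro divide_left_mono mult_pos_pos[of "norm (\<theta> - 1)"]) auto
      also have "r powr (1 - \<nu>) = inverse (r powr (\<nu> - 1))" using powr_minus[of r "\<nu> - 1"] by simp
      also have "1 / (c * inverse (r powr (\<nu> - 1))) = r powr (\<nu> - 1) / c" using c(1) r by (simp add: field_simps)
      also have "\<dots> \<le> bracket \<eta> powr (\<nu> - 1) / c"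
        using \<nu>(2) c(1) r abs_snd_le_bracket[of \<eta>] by (intro divide_right_mono powr_mono2) (auto simp: r_def)
      finally have 1: "1 / norm (\<theta> - 1) \<le> bracket \<eta> powr (\<nu> - 1) / c" .
      have 2: "1 \<le> bracket \<eta> powr (\<nu> - 1)" using \<nu>(2) by (intro ge_one_powr_ge_zero bracket_ge_1) simp
      have "norm (e p) \<le> 2 * pi * (1 + 1 / norm (\<theta> - 1))" using w(3) by (simp add: e_def norm_mult)
      also have "\<dots> \<le> 2 * pi * (bracket \<eta> powr (\<nu> - 1) + bracket \<eta> powr (\<nu> - 1) / c)"
        using 1 2 by (intro mult_left_mono add_mono) auto
      finally show ?thesis by (simp add: K_def algebra_simps)
    qed
    moreover have "periodic2 e" using w(2) periodic2_wave[of "(0, snd \<eta>)"] by (simp add: e_def periodic2_def)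
    moreover have "has_partials e (\<lambda>p. of_real (a (fst p)) * (\<i> * of_int (snd \<eta>) * e p) + wave \<eta> p)
        (\<lambda>p. \<i> * of_int (snd \<eta>) * e p)"
    proof -
      have "has_partials e (\<lambda>p. (\<i> * of_int (snd \<eta>) * of_real (a (fst p)) * w (fst p)
            + exp (\<i> * of_real (of_int (fst \<eta>) * fst p))) * wave (0, snd \<eta>) p
            + w (fst p) * (\<i> * of_int (fst (0 :: int, snd \<eta>)) * wave (0, snd \<eta>) p))
          (\<lambda>p. 0 * wave (0, snd \<eta>) p + w (fst p) * (\<i> * of_int (snd (0 :: int, snd \<eta>)) * wave (0, snd \<eta>) p))"
        unfolding e_def by (rule has_partials_mult[OF has_partials_fst[OF w(1)] has_partials_wave])
      then show ?thesis by (simp only: distrib_right wave) (simp add: e_def mult_ac)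
    qed
    ultimately show ?thesis by blast
  qed
  then show thesis by (rule that)
qed

text \<open>The arithmetic of the mean of \<open>a\<close> survives only through the exponent in
  \<open>E_bound\<close>. The sign of \<open>K\<close> is left open, so the estimates use its
  absolute value.\<close>

locale transport_solution =
  fixes a :: "real \<Rightarrow> real" and \<nu> K :: real and E :: "int \<times> int \<Rightarrow> real \<times> real \<Rightarrow> complex"
  assumes a: "a \<in> smooth_circle" and \<nu>: "1 \<le> \<nu>"
    and E_periodic: "\<eta> \<noteq> 0 \<Longrightarrow> periodic2 (E \<eta>)"
    and E_partials: "\<eta> \<noteq> 0 \<Longrightarrow>
      has_partials (E \<eta>) (\<lambda>p. of_real (a (fst p)) * (\<i> * of_int (snd \<eta>) * E \<eta> p) + wave \<eta> p)
        (\<lambda>p. \<i> * of_int (snd \<eta>) * E \<eta> p)"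
    and E_bound: "\<eta> \<noteq> 0 \<Longrightarrow> norm (E \<eta> p) \<le> K * bracket \<eta> powr (\<nu> - 1)"
begin

text \<open>Nothing is assumed about \<open>E 0\<close>, hence the recurring side condition \<open>c 0 = 0\<close>.\<close>

definition solution :: "(int \<times> int \<Rightarrow> complex) \<Rightarrow> real \<times> real \<Rightarrow> complex" where
  "solution c p = (\<Sum>\<^sub>\<infinity>\<eta>. c \<eta> * E \<eta> p)"

lemma a_bounded: obtains B where "B \<ge> 0" "\<And>t. \<bar>a t\<bar> \<le> B"
proof -
  obtain B where B: "\<And>p :: real \<times> real. norm (complex_of_real (a (fst p))) \<le> B"
    using periodic2_bounded[OF test_functionsD(1,3)[OF smooth_circleD(4)[OF a]]] by blast
  have "\<bar>a t\<bar> \<le> B" for t using B[of "(t, 0)"] by simp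
  moreover from this[of 0] have "B \<ge> 0" by linarith
  ultimately show thesis using that by blast
qed

lemma term_bound:
  assumes "c 0 = 0"
  shows "norm (c \<eta> * E \<eta> p) \<le> \<bar>K\<bar> * (bracket \<eta> powr (\<nu> - 1) * norm (c \<eta>))"
proof (cases "\<eta> = 0")
  case False
  have "norm (E \<eta> p) \<le> \<bar>K\<bar> * bracket \<eta> powr (\<nu> - 1)"
    by (rule order_trans[OF E_bound[OF False]]) (simp add: mult_right_mono)
  then have "norm (E \<eta> p) * norm (c \<eta>) \<le> \<bar>K\<bar> * bracket \<eta> powr (\<nu> - 1) * norm (c \<eta>)"
    by (rule mult_right_mono) simp
  then show ?thesis by (simp add: norm_mult mult_ac)
qed (simp add: assms)

lemma term_continuous:
  assumes "c 0 = 0"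
  shows "continuous_on S (\<lambda>p. c \<eta> * E \<eta> p)"
proof (cases "\<eta> = 0")
  case False
  then show ?thesis by (intro continuous_intros has_partials_imp_continuous_on[OF E_partials])
qed (simp add: assms)

lemma solution_summable:
  assumes "wsummable (\<nu> - 1) c"
  shows "(\<lambda>\<eta>. \<bar>K\<bar> * (bracket \<eta> powr (\<nu> - 1) * norm (c \<eta>))) summable_on UNIV"
  using assms unfolding wsummable_def by (rule summable_on_cmult_right)

lemma continuous_on_solution:
  assumes "wsummable (\<nu> - 1) c" "c 0 = 0"
  shows "continuous_on S (solution c)"
  unfolding solution_def
  by (rule continuous_on_series[OF term_continuous term_bound solution_summable]) (rule assms)+

lemma periodic2_solution:
  assumes "c 0 = 0"
  shows "periodic2 (solution c)"
proof -
  have "c \<eta> * E \<eta> (t + 2 * pi, x) = c \<eta> * E \<eta> (t, x)" "c \<eta> * E \<eta> (t, x + 2 * pi) = c \<eta> * E \<eta> (t, x)" for \<eta> t x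
    using E_periodic[of \<eta>] assms by (cases "\<eta> = 0"; simp add: periodic2_def)+
  then show ?thesis unfolding periodic2_def solution_def by (simp only: refl simp_thms)
qed

lemma has_partials_solution:
  assumes c: "wsummable \<nu> c" "c 0 = 0"
  shows "has_partials (solution c)
    (\<lambda>p. of_real (a (fst p)) * solution (\<lambda>\<eta>. \<i> * of_int (snd \<eta>) * c \<eta>) p + fourier_series c p)
    (solution (\<lambda>\<eta>. \<i> * of_int (snd \<eta>) * c \<eta>))"
proof -
  obtain B where B: "B \<ge> 0" "\<And>t. \<bar>a t\<bar> \<le> B" using a_bounded by blast
  define d where "d = (\<lambda>\<eta>. \<i> * of_int (snd \<eta>) * c \<eta>)"
  have d: "wsummable (\<nu> - 1) d" "d 0 = 0"
    using wsummable_snd[of "\<nu> - 1" c] c by (simp_all add: d_def)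
  have c1: "wsummable (\<nu> - 1) c" "wsummable 0 c" using c(1) \<nu> by (auto intro: wsummable_mono)
  \<comment> \<open>One majorant for the series and both derived series: the
    \<open>t\<close>-derivative needs the bound \<open>B\<close> of the coefficient and the norm of
    \<open>c\<close> for the character term.\<close>
  define M where "M = (\<lambda>\<eta>. (1 + B) * (\<bar>K\<bar> * (bracket \<eta> powr (\<nu> - 1) * norm (d \<eta>)))
      + norm (c \<eta>) + \<bar>K\<bar> * (bracket \<eta> powr (\<nu> - 1) * norm (c \<eta>)))"
  have "has_partials (\<lambda>p. \<Sum>\<^sub>\<infinity>\<eta>. c \<eta> * E \<eta> p)
      (\<lambda>p. \<Sum>\<^sub>\<infinity>\<eta>. of_real (a (fst p)) * (d \<eta> * E \<eta> p) + c \<eta> * wave \<eta> p) (\<lambda>p. \<Sum>\<^sub>\<infinity>\<eta>. d \<eta> * E \<eta> p)"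
  proof (rule has_partials_series)
    show "infinite (UNIV :: (int \<times> int) set)" using infinite_UNIV_int by (simp add: finite_prod)
    fix \<eta>
    show "has_partials (\<lambda>p. c \<eta> * E \<eta> p) (\<lambda>p. of_real (a (fst p)) * (d \<eta> * E \<eta> p) + c \<eta> * wave \<eta> p)
        (\<lambda>p. d \<eta> * E \<eta> p)"
    proof (cases "\<eta> = 0")
      case False
      from has_partials_cmult[OF E_partials[OF this], of "c \<eta>"] show ?thesis
        by (simp add: d_def algebra_simps)
    qed (use c(2) d(2) has_partials_const[of 0] in simp)
    fix p
    have dE: "norm (d \<eta> * E \<eta> p) \<le> \<bar>K\<bar> * (bracket \<eta> powr (\<nu> - 1) * norm (d \<eta>))" by (rule term_bound[of d, OF d(2)])
    then have adE: "norm (of_real (a (fst p)) * (d \<eta> * E \<eta> p)) \<le> B * (\<bar>K\<bar> * (bracket \<eta> powr (\<nu> - 1) * norm (d \<eta>)))"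
      unfolding norm_mult[of "of_real _"] using B by (intro mult_mono) auto
    have nn: "0 \<le> \<bar>K\<bar> * (bracket \<eta> powr (\<nu> - 1) * norm (d \<eta>))" "0 \<le> \<bar>K\<bar> * (bracket \<eta> powr (\<nu> - 1) * norm (c \<eta>))"
      by simp_all
    have nn': "0 \<le> B * (\<bar>K\<bar> * (bracket \<eta> powr (\<nu> - 1) * norm (d \<eta>)))"
      using B(1) nn(1) by (rule mult_nonneg_nonneg)
    show "norm (d \<eta> * E \<eta> p) \<le> M \<eta>"
      using dE nn nn' norm_ge_zero[of "c \<eta>"] unfolding M_def distrib_right mult_1 by linarith
    show "norm (c \<eta> * E \<eta> p) \<le> M \<eta>"
      using term_bound[of c, OF c(2), of \<eta> p] nn nn' norm_ge_zero[of "c \<eta>"]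
      unfolding M_def distrib_right mult_1 by linarith
    have "norm (of_real (a (fst p)) * (d \<eta> * E \<eta> p) + c \<eta> * wave \<eta> p)
        \<le> norm (of_real (a (fst p)) * (d \<eta> * E \<eta> p)) + norm (c \<eta>)"
      using norm_triangle_ineq[of "of_real (a (fst p)) * (d \<eta> * E \<eta> p)" "c \<eta> * wave \<eta> p"] by (simp add: norm_mult)
    then show "norm (of_real (a (fst p)) * (d \<eta> * E \<eta> p) + c \<eta> * wave \<eta> p) \<le> M \<eta>"
      using adE nn nn' unfolding M_def distrib_right mult_1 by linarith
  next
    show "M summable_on UNIV"
      unfolding M_def using c1(2)
      by (intro summable_on_add summable_on_cmult_right[of "\<lambda>\<eta>. \<bar>K\<bar> * _ \<eta>"] solution_summable c1 d)
        (simp add: wsummable_0_iff)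
  qed
  moreover have "(\<Sum>\<^sub>\<infinity>\<eta>. of_real (a (fst p)) * (d \<eta> * E \<eta> p) + c \<eta> * wave \<eta> p)
      = of_real (a (fst p)) * solution d p + fourier_series c p" for p
  proof -
    have "(\<lambda>\<eta>. d \<eta> * E \<eta> p) summable_on UNIV"
      using term_bound[of d, OF d(2)] solution_summable[OF d(1)] by (rule norm_le_summable_on)
    moreover have "(\<lambda>\<eta>. c \<eta> * wave \<eta> p) summable_on UNIV"
      using c1(2) unfolding wsummable_0_iff by (rule norm_le_summable_on[rotated]) (simp add: norm_mult)
    ultimately show ?thesis
      by (simp add: infsum_add summable_on_cmult_right infsum_cmult_right' solution_def fourier_series_def)
  qed
  ultimately show ?thesis by (simp add: solution_def[abs_def] d_def)
qed

text \<open>Each derivative replaces \<open>c\<close> by its product with i \<xi>, which uses one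
  unit of weight. The \<open>t\<close>-derivative also adds the Fourier series of \<open>c\<close>
  itself, for which weight \<open>n\<close> suffices.\<close>

lemma cont_diff_solution:
  assumes "wsummable (real n + (\<nu> - 1)) c" "c 0 = 0"
  shows "cont_diff n (solution c)"
  using assms
proof (induction n arbitrary: c)
  case 0
  then show ?case by (simp add: continuous_on_solution)
next
  case (Suc n)
  have w: "wsummable \<nu> c" "wsummable (real n) c" "wsummable ((real n + (\<nu> - 1)) + 1) c"
    using Suc.prems(1) \<nu> by (auto intro: wsummable_mono)
  have "cont_diff n (solution (\<lambda>\<eta>. \<i> * of_int (snd \<eta>) * c \<eta>))"
    using Suc.IH[OF wsummable_snd[OF w(3)]] by simp
  then show ?case
    by (intro cont_diff_SucI[OF has_partials_solution[OF w(1) Suc.prems(2)]] cont_diff_add cont_diff_mult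
        cont_diff_fourier_series[OF w(2)] test_functionsD(2)[OF smooth_circleD(4)[OF a]])
qed

lemma solution_test_function:
  assumes "\<And>s. wsummable s c" "c 0 = 0"
  shows "solution c \<in> test_functions"
  using assms by (simp add: test_functions_def periodic2_solution cont_diff_solution)

lemma transport_solution_eq:
  assumes "wsummable \<nu> c" "c 0 = 0"
  shows "transport a (solution c) = fourier_series c"
  using has_partials_imp_eq[OF has_partials_solution[OF assms]] by (simp add: transport_def)

text \<open>At weight \<nu> - 1 the series is only known to be continuous, so it cannot be
  integrated by parts as a whole. The transpose identity is applied to each differentiable
  \<open>E \<eta>\<close>, and the results are summed.\<close>

lemma integral_solution_transport:
  assumes c: "wsummable (\<nu> - 1) c" "c 0 = 0" and \<phi>: "\<phi> \<in> test_functions"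
  shows "integral torus (\<lambda>p. solution c p * transport a \<phi> p) = - integral torus (\<lambda>p. fourier_series c p * \<phi> p)"
proof -
  note T\<phi> = test_functionsD[OF transport_test_function[OF a \<phi>]]
  obtain B where B: "\<And>p. norm (transport a \<phi> p) \<le> B" using periodic2_bounded[OF T\<phi>(1,3)] by blast
  then have "B \<ge> 0" using norm_ge_zero order_trans by blast
  have "((\<lambda>\<eta>. integral torus (\<lambda>p. c \<eta> * E \<eta> p * transport a \<phi> p)) has_sum
      integral torus (\<lambda>p. \<Sum>\<^sub>\<infinity>\<eta>. c \<eta> * E \<eta> p * transport a \<phi> p)) UNIV"
  proof (rule has_sum_integral_torus)
    show "norm (c \<eta> * E \<eta> p * transport a \<phi> p) \<le> \<bar>K\<bar> * (bracket \<eta> powr (\<nu> - 1) * norm (c \<eta>)) * B" for \<eta> p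
      unfolding norm_mult[of "c \<eta> * E \<eta> p"] using term_bound[of c, OF c(2)] B by (intro mult_mono) auto
    show "(\<lambda>\<eta>. \<bar>K\<bar> * (bracket \<eta> powr (\<nu> - 1) * norm (c \<eta>)) * B) summable_on UNIV"
      by (intro summable_on_cmult_left solution_summable c)
  qed (intro continuous_on_mult term_continuous[of c, OF c(2)] T\<phi>)
  moreover have "(\<Sum>\<^sub>\<infinity>\<eta>. c \<eta> * E \<eta> p * transport a \<phi> p) = solution c p * transport a \<phi> p" for p
    by (simp add: infsum_cmult_left' solution_def)
  moreover have "integral torus (\<lambda>p. c \<eta> * E \<eta> p * transport a \<phi> p) = - (4 * pi\<^sup>2 * (c \<eta> * fourier_fun \<phi> (- \<eta>)))" for \<eta>
  proof (cases "\<eta> = 0")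
    case False
    let ?a = "\<lambda>p. complex_of_real (a (fst p))"
    note cE = has_partials_imp_continuous_on[OF E_partials[OF False]]
    have "integral torus (\<lambda>p. E \<eta> p * transport a \<phi> p) = - integral torus (\<lambda>p. (?a p * (\<i> * of_int (snd \<eta>) * E \<eta> p)
        + wave \<eta> p - ?a p * (\<i> * of_int (snd \<eta>) * E \<eta> p)) * \<phi> p)"
      by (intro integral_torus_transport a \<phi> E_partials E_periodic False continuous_intros cE
          test_functionsD(3)[OF smooth_circleD(4)[OF a]])
    also have "\<dots> = - (4 * pi\<^sup>2 * fourier_fun \<phi> (- \<eta>))"
      by (simp add: integral_torus_mult_wave mult.commute[of "wave \<eta> _"])
    finally show ?thesis by (simp add: mult.assoc)
  qed (simp add: c(2))
  ultimately have "((\<lambda>\<eta>. - (4 * pi\<^sup>2 * (c \<eta> * fourier_fun \<phi> (- \<eta>)))) has_sum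
      integral torus (\<lambda>p. solution c p * transport a \<phi> p)) UNIV" by simp
  moreover have "((\<lambda>\<eta>. - (4 * pi\<^sup>2 * (c \<eta> * fourier_fun \<phi> (- \<eta>)))) has_sum
      - integral torus (\<lambda>p. fourier_series c p * \<phi> p)) UNIV"
    using has_sum_integral_fourier_series_mult[OF wsummable_mono[OF c(1)] test_functionsD(3,1)[OF \<phi>]] \<nu>
    by (simp add: has_sum_uminus)
  ultimately show ?thesis by (rule has_sum_unique)
qed

section \<open>Distributional solutions: uniqueness, existence and regularity\<close>

lemma distribution_solution_unique:
  assumes u: "u \<in> distributions" "v \<in> distributions"
    and eq: "vector_field_op a u = vector_field_op a v" and one: "u (\<lambda>p. 1) = v (\<lambda>p. 1)"
  shows "u = v"
proof (rule distribution_eqI[OF u[THEN distributionsD(1)]])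
  fix \<phi> assume \<phi>: "\<phi> \<in> test_functions"
  define \<kappa> where "\<kappa> = fourier_fun \<phi> 0"
  \<comment> \<open>Deleting the zero frequency leaves the mean-zero part of \<phi>, on which the
    solution operator acts.\<close>
  define d where "d = (\<lambda>\<eta>. if \<eta> \<in> {0} then 0 else fourier_fun \<phi> \<eta>)"
  have c: "wsummable s (fourier_fun \<phi>)" for s by (rule wsummable_fourier_fun_test_function[OF \<phi>])
  have d: "wsummable s d" for s
    using c[of s] unfolding wsummable_def by (rule summable_on_comparison_test) (auto simp: d_def)
  have d0: "d 0 = 0" by (simp add: d_def)
  have \<psi>: "solution d \<in> test_functions" by (rule solution_test_function[OF d d0])
  have "\<phi> = fourier_series (fourier_fun \<phi>)"
    using fourier_inversion[OF test_functionsD(3,1)[OF \<phi>] c] by simp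
  also have "\<dots> = (\<lambda>p. \<kappa> * 1 + fourier_series d p)"
    using fourier_series_split[OF c, of "{0}"] unfolding d_def \<kappa>_def by (simp add: zero_prod_def fun_eq_iff)
  finally have \<phi>_eq: "\<phi> = (\<lambda>p. \<kappa> * 1 + transport a (solution d) p)"
    by (simp add: transport_solution_eq d d0)
  \<comment> \<open>Every distribution is recovered from its value at the constant 1 and its image
    under the operator.\<close>
  have *: "w \<phi> = \<kappa> * w (\<lambda>p. 1) - vector_field_op a w (solution d)" if w: "w \<in> distributions" for w
  proof -
    have "w \<phi> = w (\<lambda>p. \<kappa> * 1) + w (transport a (solution d))"
      by (subst \<phi>_eq, rule distributionsD(2)[OF w test_functions_const transport_test_function[OF a \<psi>]])
    then show ?thesis
      using distributionsD(3)[OF w test_functions_const[of 1], of \<kappa>] by (simp add: vector_field_op_apply[OF a w \<psi>])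
  qed
  show "u \<phi> = v \<phi>" using *[OF u(1)] *[OF u(2)] eq one by simp
qed

text \<open>The weight suffices for \<open>f\<close> to be the distribution of its Fourier series,
  so the weak identity for \<open>solution\<close> becomes an equality of distributions. The
  constant \<open>b\<close>, which the operator annihilates, stays free for adjusting the
  mean.\<close>

lemma vector_field_op_solution:
  assumes f: "f \<in> distributions" "wsummable (\<nu> - 1) (fourier_coeff f)" "fourier_coeff f (0, 0) = 0"
  shows "vector_field_op a (distr_of (\<lambda>p. solution (fourier_coeff f) p + b)) = f"
proof (rule distribution_eqI)
  let ?c = "fourier_coeff f"
  have c: "wsummable (\<nu> - 1) ?c" "?c 0 = 0" "wsummable 0 ?c"
    using f(2,3) \<nu> by (auto simp: zero_prod_def intro: wsummable_mono)
  have v: "distr_of (\<lambda>p. solution ?c p + b) \<in> distributions"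
    using periodic2_solution[of ?c, OF c(2)]
    by (intro distr_of_distribution continuous_intros continuous_on_solution c) (simp add: periodic2_def)
  fix \<phi> assume \<phi>: "\<phi> \<in> test_functions"
  note T\<phi> = transport_test_function[OF a \<phi>]
  have "integral torus (\<lambda>p. b * transport a \<phi> p) = 0"
    using integral_torus_transport[OF a \<phi> has_partials_const[of b]] by (simp add: periodic2_def)
  then have "vector_field_op a (distr_of (\<lambda>p. solution ?c p + b)) \<phi> = integral torus (\<lambda>p. fourier_series ?c p * \<phi> p)"
    using integral_solution_transport[of ?c, OF c(1,2) \<phi>]
    by (simp only: vector_field_op_apply[OF a v \<phi>] distr_of_apply[OF T\<phi>] distrib_right)
      (simp add: integral_torus_add continuous_intros continuous_on_solution c test_functionsD(3)[OF T\<phi>])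
  also have "\<dots> = f \<phi>"
    using distribution_eq_distr_of_fourier_series[OF f(1) c(3)] distr_of_apply[OF \<phi>] by metis
  finally show "vector_field_op a (distr_of (\<lambda>p. solution ?c p + b)) \<phi> = f \<phi>" .
qed (use distributionsD(1)[OF f(1)] in \<open>auto simp: vector_field_op_def\<close>)

text \<open>The transpose annihilates constants, so the mean-zero condition on the right-hand side
  is automatic as soon as a solution exists.\<close>

lemma vector_field_op_mean:
  assumes u: "u \<in> distributions"
  shows "fourier_coeff (vector_field_op a u) (0, 0) = 0"
proof -
  have "transport a (\<lambda>p. 1) = (\<lambda>p. 0)"
    using has_partials_imp_eq[OF has_partials_const[of 1]] by (simp add: transport_def)
  then show ?thesis
    by (simp add: fourier_coeff_0 vector_field_op_apply[OF a u test_functions_const] distribution_0[OF u])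
qed

text \<open>The mean of the series is replaced by the prescribed value \<open>b\<close>: 0 for the
  normalised solution, the mean of \<open>u\<close> when comparing with a given
  \<open>u\<close>.\<close>

definition regular_solution :: "((real \<times> real \<Rightarrow> complex) \<Rightarrow> complex) \<Rightarrow> complex \<Rightarrow> real \<times> real \<Rightarrow> complex" where
  "regular_solution f b = (\<lambda>p. solution (fourier_coeff f) p + (b - fourier_fun (solution (fourier_coeff f)) (0, 0)))"

context
  fixes f :: "(real \<times> real \<Rightarrow> complex) \<Rightarrow> complex" and m :: nat
  assumes f: "f \<in> distributions" "wsummable (real m + (\<nu> - 1)) (fourier_coeff f)" "fourier_coeff f (0, 0) = 0"
begin

lemma regular_solution_cont_diff:
  "periodic2 (regular_solution f b)" "cont_diff m (regular_solution f b)"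
  using periodic2_solution[of "fourier_coeff f"] cont_diff_solution[OF f(2)] f(3)
  by (auto simp: regular_solution_def zero_prod_def periodic2_def intro: cont_diff_add cont_diff_const)

lemma regular_solution_distribution: "distr_of (regular_solution f b) \<in> distributions"
  by (intro distr_of_distribution cont_diff_imp_continuous_on[OF regular_solution_cont_diff(2)]
      regular_solution_cont_diff)

lemma vector_field_op_regular_solution: "vector_field_op a (distr_of (regular_solution f b)) = f"
  unfolding regular_solution_def
  by (rule vector_field_op_solution[OF f(1) wsummable_mono[OF f(2)] f(3)]) simp

lemma fourier_coeff_regular_solution: "fourier_coeff (distr_of (regular_solution f b)) (0, 0) = b"
proof -
  have "continuous_on UNIV (solution (fourier_coeff f))"
    using cont_diff_solution[OF f(2)] f(3) cont_diff_imp_continuous_on by (auto simp: zero_prod_def)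
  then have "integral torus (regular_solution f b) = integral torus (solution (fourier_coeff f))
      + 4 * pi\<^sup>2 * (b - fourier_fun (solution (fourier_coeff f)) (0, 0))"
    unfolding regular_solution_def
    by (subst integral_torus_add) (auto intro: continuous_intros simp: integral_torus_const simp del: integral_const)
  also have "\<dots> = 4 * pi\<^sup>2 * b"
    by (simp add: fourier_fun_0 right_diff_distrib)
  finally show ?thesis by (simp add: fourier_coeff_distr_of fourier_fun_0)
qed

text \<open>Both sides solve the same equation and have the same mean, so uniqueness identifies them
  and \<open>u\<close> inherits the regularity of the explicit series.\<close>

lemma distribution_solution_eq_regular:
  assumes u: "u \<in> distributions" "vector_field_op a u = f"
  shows "u = distr_of (regular_solution f (fourier_coeff u (0, 0)))"
proof (rule distribution_solution_unique[OF u(1) regular_solution_distribution])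
  show "vector_field_op a u = vector_field_op a (distr_of (regular_solution f (fourier_coeff u (0, 0))))"
    by (simp add: u(2) vector_field_op_regular_solution)
  show "u (\<lambda>p. 1) = distr_of (regular_solution f (fourier_coeff u (0, 0))) (\<lambda>p. 1)"
    using fourier_coeff_regular_solution[of "fourier_coeff u (0, 0)"] by (simp add: fourier_coeff_0)
qed

end

end

theorem corollary6p10:
  fixes a :: "real \<Rightarrow> real" and k :: real and m :: nat
  assumes "a \<in> smooth_circle"
    and "mean_circle a \<notin> \<rat>"
    and "irrationality_measure (mean_circle a) < \<infinity>"
    and "irrationality_measure (mean_circle a) < ereal k"
    and "int m = \<lceil>k - real_of_ereal (irrationality_measure (mean_circle a))\<rceil> - 1"
  shows "(\<forall>f\<in>sobolev k. \<forall>u\<in>distributions. vector_field_op a u = f \<longrightarrow> u \<in> cont_diff_distr m)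
    \<and> (\<forall>n :: nat. k = real n \<longrightarrow>
          (\<forall>f\<in>cont_diff_distr n. \<forall>u\<in>distributions.
             vector_field_op a u = f \<longrightarrow> u \<in> cont_diff_distr m))
    \<and> (\<forall>f. f \<in> sobolev k \<or> (\<exists>n :: nat. k = real n \<and> f \<in> cont_diff_distr n) \<longrightarrow>
          fourier_coeff f (0, 0) = 0 \<longrightarrow>
          (\<exists>!u. u \<in> distributions \<and> vector_field_op a u = f \<and> fourier_coeff u (0, 0) = 0) \<and>
          (\<forall>u\<in>distributions. vector_field_op a u = f \<and> fourier_coeff u (0, 0) = 0 \<longrightarrow>
             u \<in> cont_diff_distr m))"
proof -
  define \<mu> where "\<mu> = real_of_ereal (irrationality_measure (mean_circle a))"
  have \<mu>: "irrationality_measure (mean_circle a) = ereal \<mu>" "\<mu> \<ge> 1"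
    using assms(3) irrationality_measure_ge_1[of "mean_circle a"]
    unfolding \<mu>_def by (cases "irrationality_measure (mean_circle a)"; simp add: one_ereal_def)+
  \<comment> \<open>The ceiling minus 1 is the largest integer strictly below k - \<mu>, also when
    this difference is an integer.\<close>
  have "real m < k - \<mu>"
    using assms(5) unfolding \<mu>_def[symmetric] by linarith
  \<comment> \<open>The small divisor bound asks for \<nu> > \<mu>, and \<nu> < k - m gives m +
    \<nu> - 1 < k - 1, the margin in \<open>wsummable_l2\<close>.\<close>
  then obtain \<nu> where \<nu>_bounds: "\<mu> < \<nu>" "\<nu> < k - real m"
    using dense[of \<mu> "k - real m"] by auto
  obtain K where K: "\<And>\<eta>. \<eta> \<noteq> 0 \<Longrightarrow> \<exists>e. periodic2 e \<and>
      has_partials e (\<lambda>p. of_real (a (fst p)) * (\<i> * of_int (snd \<eta>) * e p) + wave \<eta> p)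
        (\<lambda>p. \<i> * of_int (snd \<eta>) * e p) \<and>
      (\<forall>p. norm (e p) \<le> K * bracket \<eta> powr (\<nu> - 1))"
    using transport_frequency_solution[OF assms(1,2), of \<nu>] \<mu> \<nu>_bounds(1) by auto
  \<comment> \<open>The guard sits inside the existential so that a choice function on the whole
    lattice exists; its value at 0 is arbitrary.\<close>
  then have "\<forall>\<eta>. \<exists>e. \<eta> \<noteq> 0 \<longrightarrow> periodic2 e \<and>
      has_partials e (\<lambda>p. of_real (a (fst p)) * (\<i> * of_int (snd \<eta>) * e p) + wave \<eta> p)
        (\<lambda>p. \<i> * of_int (snd \<eta>) * e p) \<and>
      (\<forall>p. norm (e p) \<le> K * bracket \<eta> powr (\<nu> - 1))"
    by blast
  from choice[OF this] obtain E where E: "\<And>\<eta>. \<eta> \<noteq> 0 \<Longrightarrow> periodic2 (E \<eta>) \<and>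
      has_partials (E \<eta>) (\<lambda>p. of_real (a (fst p)) * (\<i> * of_int (snd \<eta>) * E \<eta> p) + wave \<eta> p)
        (\<lambda>p. \<i> * of_int (snd \<eta>) * E \<eta> p) \<and>
      (\<forall>p. norm (E \<eta> p) \<le> K * bracket \<eta> powr (\<nu> - 1))"
    by blast
  interpret transport_solution a \<nu> K E
    by unfold_locales (use assms(1) \<mu>(2) \<nu>_bounds(1) E in auto)
  have sob: "f \<in> distributions \<and> wsummable (real m + (\<nu> - 1)) (fourier_coeff f)" if "f \<in> sobolev k" for f
    using that \<nu>_bounds(2) by (auto simp: sobolev_def intro: wsummable_l2)
  \<comment> \<open>C^n embeds in H^n, so the claims about classical data reduce to those about
    Sobolev data.\<close>
  have cd: "f \<in> sobolev k" if "k = real n" "f \<in> cont_diff_distr n" for f n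
    using that distr_of_sobolev by (auto simp: cont_diff_distr_def)
  have regular: "u \<in> cont_diff_distr m"
    if "f \<in> sobolev k" "u \<in> distributions" "vector_field_op a u = f" for f u
  proof -
    have "fourier_coeff f (0, 0) = 0" using vector_field_op_mean that by blast
    note f = sob[OF that(1), THEN conjunct1] sob[OF that(1), THEN conjunct2] this
    show ?thesis
      using distribution_solution_eq_regular[OF f that(2,3)] regular_solution_cont_diff[OF f]
      unfolding cont_diff_distr_def by blast
  qed
  have unique: "\<exists>!u. u \<in> distributions \<and> vector_field_op a u = f \<and> fourier_coeff u (0, 0) = 0"
    if "f \<in> sobolev k" "fourier_coeff f (0, 0) = 0" for f
  proof -
    note f = sob[OF that(1), THEN conjunct1] sob[OF that(1), THEN conjunct2] that(2)
    show ?thesis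
    proof (intro ex1I[of _ "distr_of (regular_solution f 0)"] conjI)
      show "u = distr_of (regular_solution f 0)"
        if "u \<in> distributions \<and> vector_field_op a u = f \<and> fourier_coeff u (0, 0) = 0" for u
        using distribution_solution_eq_regular[OF f, of u] that by simp
    qed (rule regular_solution_distribution[OF f] vector_field_op_regular_solution[OF f]
        fourier_coeff_regular_solution[OF f])+
  qed
  from cd regular unique show ?thesis by blast
qed

end
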